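(* Let $\Theta:\mathcal{L}(A,B)\to\mathcal{L}(C,D)$ and $\Gamma:\mathcal{L}(A',B')\to\mathcal{L}(C',D')$ be any two superchannels. Then the superchannel entropy is subadditive under tensor product: $$S[\Theta\otimes\Gamma]\ \le\ S[\Theta]+S[\Gamma].$$
   Context: All Hilbert spaces are finite-dimensional. $\mathcal{L}(A)$ is the space of linear operators on $A$, $\mathcal{L}(A,B)$ the space of linear maps $\mathcal{L}(A)\to\mathcal{L}(B)$; $\mathcal{L}(A,B)_+$ denotes the set of quantum channels (CPTP maps) in it. A supermap is a linear map $\Theta:\mathcal{L}(A,B)\to\mathcal{L}(C,D)$; it is CP-preserving if it maps CP maps to CP maps, completely CP-preserving if $\mathrm{id}\otimes\Theta$ is CP-preserving on $\mathcal{L}(E,E')\otimes\mathcal{L}(A,B)$ for all $E,E'$, and TP-preserving if it maps trace-preserving maps to trace-preserving maps. A superchannel is a completely CP-preserving and TP-preserving supermap. For $\rho$ a state and $\sigma\ge0$, $D(\rho\|\sigma)=\mathrm{tr}(\rho(\log\rho-\log\sigma))$ if $\mathrm{supp}\,\rho\subseteq\mathrm{supp}\,\sigma$ and $+\infty$ otherwise. For a channel $\mathcal{N}$ and a CP map $\mathcal{M}$ in $\mathcal{L}(A,B)$, $D[\mathcal{N}\|\mathcal{M}]=\sup_{\rho_{RA}}D(\mathrm{id}_R\otimes\mathcal{N}(\rho_{RA})\|\mathrm{id}_R\otimes\mathcal{M}(\rho_{RA}))$ over all reference systems $R$ and states on $R\otimes A$. For a superchannel $\Theta$ and a completely CP-preserving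 supermap $\Gamma$, both $\mathcal{L}(A,B)\to\mathcal{L}(C,D)$, $$D^{(2)}[\Theta\|\Gamma]=\sup_{R,\ \mathcal{N}\in\mathcal{L}(R\otimes A,R\otimes B)_+}D[(\mathrm{id}\otimes\Theta)(\mathcal{N})\,\|\,(\mathrm{id}\otimes\Gamma)(\mathcal{N})],$$ with $R$ an arbitrary Hilbert space and $\mathrm{id}$ the identity supermap on $\mathcal{L}(R,R)$. The completely depolarizing supermap $\mathcal{R}^{(2)}:\mathcal{L}(A,B)\to\mathcal{L}(C,D)$ is $\mathcal{R}^{(2)}(X)=\mathrm{tr}(\widehat{\mathsf C}_X)\,\mathcal{R}_{C\to D}$, where $\widehat{\mathsf C}_X=\sum_{i,j}e_{ij}\otimes X(e_{ij})$ is the Choi operator ($e_{ij}$ matrix units of $\mathcal{L}(A)$) and $\mathcal{R}_{C\to D}(Y)=\mathrm{tr}(Y)\mathbb{1}_D$. The entropy of a superchannel is $S[\Theta]:=-D^{(2)}[\Theta\|\mathcal{R}^{(2)}]$. The tensor product $\Theta\otimes\Gamma$ acts from $\mathcal{L}(A\otimes A',B\otimes B')$ to $\mathcal{L}(C\otimes C',D\otimes D')$, and its completely depolarizing supermap is the tensor product of those of the factors. *)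

theory Defs
  imports "HOL-Analysis.Analysis"
begin

text \<open>
  A finite-dimensional Hilbert space is given by a finite nonempty set labelling an orthonormal
  basis: the set \<open>A\<close> stands for \<open>\<complex>\<^sup>A\<close>, and \<open>A \<times> B\<close> for the tensor product. Labels are elements of
  an arbitrary type, and not the elements of a finite type, because reference systems of every
  dimension are quantified over inside the definitions; these are \<open>\<complex>\<^sup>n\<close>, labelled by \<open>{..<n}\<close>
  with \<open>n > 0\<close>.
\<close>

type_synonym 'a vect = "'a \<Rightarrow> complex"
type_synonym 'a oper = "'a \<Rightarrow> 'a \<Rightarrow> complex"
type_synonym ('a, 'b) omap = "'a oper \<Rightarrow> 'b oper"
type_synonym ('a, 'b, 'c, 'd) supermap = "('a, 'b) omap \<Rightarrow> ('c, 'd) omap"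

definition hilbert_space :: "'a set \<Rightarrow> bool" where
  "hilbert_space A \<longleftrightarrow> finite A \<and> A \<noteq> {}"


subsection \<open>Vectors and operators\<close>

definition vects :: "'a set \<Rightarrow> 'a vect set" where
  "vects A = {v. \<forall>i. i \<notin> A \<longrightarrow> v i = 0}"

definition opers :: "'a set \<Rightarrow> 'a oper set" where
  "opers A = {X. \<forall>i j. i \<notin> A \<or> j \<notin> A \<longrightarrow> X i j = 0}"

definition compress :: "'a set \<Rightarrow> 'a oper \<Rightarrow> 'a oper" where
  "compress A X = (\<lambda>i j. if i \<in> A \<and> j \<in> A then X i j else 0)"

definition inner_on :: "'a set \<Rightarrow> 'a vect \<Rightarrow> 'a vect \<Rightarrow> complex" where
  "inner_on A u v = (\<Sum>i\<in>A. cnj (u i) * v i)"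

definition apply_op :: "'a set \<Rightarrow> 'a oper \<Rightarrow> 'a vect \<Rightarrow> 'a vect" where
  "apply_op A X v = (\<lambda>i. \<Sum>j\<in>A. X i j * v j)"

definition op_mult :: "'a set \<Rightarrow> 'a oper \<Rightarrow> 'a oper \<Rightarrow> 'a oper" where
  "op_mult A X Y = (\<lambda>i k. \<Sum>j\<in>A. X i j * Y j k)"

definition op_id :: "'a set \<Rightarrow> 'a oper" where
  "op_id A = (\<lambda>i j. if i = j \<and> i \<in> A then 1 else 0)"

definition tr :: "'a set \<Rightarrow> 'a oper \<Rightarrow> complex" where
  "tr A X = (\<Sum>i\<in>A. X i i)"

definition munit :: "'a \<Rightarrow> 'a \<Rightarrow> 'a oper" where
  "munit i j = (\<lambda>k l. if k = i \<and> l = j then 1 else 0)"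

definition tensor_op :: "'a oper \<Rightarrow> 'b oper \<Rightarrow> ('a \<times> 'b) oper" where
  "tensor_op X Y = (\<lambda>(a, b) (a', b'). X a a' * Y b b')"

definition positive :: "'a set \<Rightarrow> 'a oper \<Rightarrow> bool" where
  "positive A X \<longleftrightarrow>
     X \<in> opers A \<and> (\<forall>v\<in>vects A. inner_on A v (apply_op A X v) \<in> \<real>\<^sub>\<ge>\<^sub>0)"

definition states :: "'a set \<Rightarrow> 'a oper set" where
  "states A = {\<rho>. positive A \<rho> \<and> tr A \<rho> = 1}"

definition kernel :: "'a set \<Rightarrow> 'a oper \<Rightarrow> 'a vect set" where
  "kernel A X = {v \<in> vects A. apply_op A X v = (\<lambda>i. 0)}"

definition supp :: "'a set \<Rightarrow> 'a oper \<Rightarrow> 'a vect set" where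
  "supp A X = {v \<in> vects A. \<forall>w\<in>kernel A X. inner_on A w v = 0}"


subsection \<open>Functional calculus and relative entropy\<close>

text \<open>
  \<open>X\<close> is the sum of \<open>l k |u k\<rangle>\<langle>u k|\<close> for an orthonormal basis \<open>u\<close>; since a basis of \<open>\<complex>\<^sup>A\<close> has
  as many members as \<open>A\<close>, it is indexed by \<open>A\<close> itself.
\<close>

definition spectral_decomposition ::
  "'a set \<Rightarrow> 'a oper \<Rightarrow> ('a \<Rightarrow> 'a vect) \<Rightarrow> ('a \<Rightarrow> real) \<Rightarrow> bool" where
  "spectral_decomposition A X u l \<longleftrightarrow>
     (\<forall>k\<in>A. u k \<in> vects A) \<and>
     (\<forall>k\<in>A. \<forall>m\<in>A. inner_on A (u k) (u m) = (if k = m then 1 else 0)) \<and>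
     X = (\<lambda>i j. \<Sum>k\<in>A. of_real (l k) * u k i * cnj (u k j))"

definition op_fun :: "'a set \<Rightarrow> (real \<Rightarrow> real) \<Rightarrow> 'a oper \<Rightarrow> 'a oper" where
  "op_fun A f X =
     (THE F. \<exists>u l. spectral_decomposition A X u l \<and>
        F = (\<lambda>i j. \<Sum>k\<in>A. of_real (f (l k)) * u k i * cnj (u k j)))"

text \<open>
  The logarithm is natural. As \<^prop>\<open>ln (0::real) = 0\<close>, it vanishes on the kernel of a positive
  operator, which is the usual convention \<open>0 log 0 = 0\<close>; under the support condition below the
  trace does not depend on the values on the kernels.
\<close>

definition op_log :: "'a set \<Rightarrow> 'a oper \<Rightarrow> 'a oper" where
  "op_log A X = op_fun A ln X"

definition rel_entropy :: "'a set \<Rightarrow> 'a oper \<Rightarrow> 'a oper \<Rightarrow> ereal" where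
  "rel_entropy A \<rho> \<sigma> =
     (if supp A \<rho> \<subseteq> supp A \<sigma>
      then ereal (Re (tr A (op_mult A \<rho> (\<lambda>i j. op_log A \<rho> i j - op_log A \<sigma> i j))))
      else \<infinity>)"


subsection \<open>Linear maps between operator spaces\<close>

text \<open>
  A linear map from \<open>opers A\<close> to \<open>opers B\<close> is represented by its composition with the
  compression onto \<open>opers A\<close>, so that each such map has exactly one representative and equality
  in \<open>lmaps A B\<close> is equality of functions.
\<close>

definition lmaps :: "'a set \<Rightarrow> 'b set \<Rightarrow> ('a, 'b) omap set" where
  "lmaps A B = {N.
     (\<forall>c X Y. N (\<lambda>i j. c * X i j + Y i j) = (\<lambda>k l. c * N X k l + N Y k l)) \<and>
     (\<forall>X. N X \<in> opers B) \<and>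
     (\<forall>X. N (compress A X) = N X)}"

text \<open>
  The linear map with \<open>X \<otimes> Y \<mapsto> N X \<otimes> M Y\<close>, written out on the matrix units of the product.
\<close>

definition tensor_map ::
  "'a set \<Rightarrow> 'c set \<Rightarrow> ('a, 'b) omap \<Rightarrow> ('c, 'd) omap \<Rightarrow> ('a \<times> 'c, 'b \<times> 'd) omap" where
  "tensor_map A A' N M = (\<lambda>X p q.
     \<Sum>(i, i')\<in>A \<times> A'. \<Sum>(j, j')\<in>A \<times> A'.
       X (i, i') (j, j') * tensor_op (N (munit i j)) (M (munit i' j')) p q)"

abbreviation id_tensor_map :: "'r set \<Rightarrow> 'a set \<Rightarrow> ('a, 'b) omap \<Rightarrow> ('r \<times> 'a, 'r \<times> 'b) omap" where
  "id_tensor_map R A N \<equiv> tensor_map R A (compress R) N"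

definition CP :: "'a set \<Rightarrow> 'b set \<Rightarrow> ('a, 'b) omap \<Rightarrow> bool" where
  "CP A B N \<longleftrightarrow> N \<in> lmaps A B \<and>
     (\<forall>n>0. \<forall>X. positive ({..<n::nat} \<times> A) X \<longrightarrow>
        positive ({..<n} \<times> B) (id_tensor_map {..<n} A N X))"

definition TP :: "'a set \<Rightarrow> 'b set \<Rightarrow> ('a, 'b) omap \<Rightarrow> bool" where
  "TP A B N \<longleftrightarrow> N \<in> lmaps A B \<and> (\<forall>X\<in>opers A. tr B (N X) = tr A X)"

definition channels :: "'a set \<Rightarrow> 'b set \<Rightarrow> ('a, 'b) omap set" where
  "channels A B = {N. CP A B N \<and> TP A B N}"

definition channel_div :: "'a set \<Rightarrow> 'b set \<Rightarrow> ('a, 'b) omap \<Rightarrow> ('a, 'b) omap \<Rightarrow> ereal" where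
  "channel_div A B N M =
     (SUP n\<in>{0<..}. SUP \<rho>\<in>states ({..<n::nat} \<times> A).
        rel_entropy ({..<n} \<times> B) (id_tensor_map {..<n} A N \<rho>) (id_tensor_map {..<n} A M \<rho>))"


subsection \<open>Supermaps\<close>

text \<open>Only the values of a supermap on \<open>lmaps A B\<close> are ever used.\<close>

definition supermaps ::
  "'a set \<Rightarrow> 'b set \<Rightarrow> 'c set \<Rightarrow> 'd set \<Rightarrow> ('a, 'b, 'c, 'd) supermap set" where
  "supermaps A B C D = {\<Theta>.
     (\<forall>N\<in>lmaps A B. \<Theta> N \<in> lmaps C D) \<and>
     (\<forall>c. \<forall>N\<in>lmaps A B. \<forall>M\<in>lmaps A B.
        \<Theta> (\<lambda>X k l. c * N X k l + M X k l) = (\<lambda>Y k l. c * \<Theta> N Y k l + \<Theta> M Y k l))}"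

text \<open>
  The maps \<open>map_unit i j k l\<close>, with \<open>i\<close>, \<open>j\<close> in \<open>A\<close> and \<open>k\<close>, \<open>l\<close> in \<open>B\<close>, form a basis of
  \<open>lmaps A B\<close>, in which \<open>N\<close> has the coefficients \<open>N (munit i j) k l\<close>.
\<close>

definition map_unit :: "'a \<Rightarrow> 'a \<Rightarrow> 'b \<Rightarrow> 'b \<Rightarrow> ('a, 'b) omap" where
  "map_unit i j k l = (\<lambda>X r s. X i j * munit k l r s)"

text \<open>
  The linear supermap with \<open>N \<otimes> M \<mapsto> \<Theta> N \<otimes> \<Gamma> M\<close>, written out on the basis \<^const>\<open>map_unit\<close>.
\<close>

definition tensor_supermap ::
  "'a set \<Rightarrow> 'b set \<Rightarrow> 'c set \<Rightarrow> 'e set \<Rightarrow> 'f set \<Rightarrow> 'g set \<Rightarrow>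
   ('a, 'b, 'c, 'd) supermap \<Rightarrow> ('e, 'f, 'g, 'h) supermap \<Rightarrow>
   ('a \<times> 'e, 'b \<times> 'f, 'c \<times> 'g, 'd \<times> 'h) supermap" where
  "tensor_supermap A B C A' B' C' \<Theta> \<Gamma> = (\<lambda>N Y p q.
     \<Sum>(i, i')\<in>A \<times> A'. \<Sum>(j, j')\<in>A \<times> A'. \<Sum>(k, k')\<in>B \<times> B'. \<Sum>(l, l')\<in>B \<times> B'.
       N (munit (i, i') (j, j')) (k, k') (l, l') *
       tensor_map C C' (\<Theta> (map_unit i j k l)) (\<Gamma> (map_unit i' j' k' l')) Y p q)"

text \<open>The identity supermap on \<open>lmaps E E'\<close>, tensored with \<open>\<Theta>\<close>.\<close>

abbreviation id_tensor_supermap ::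
  "'e set \<Rightarrow> 'f set \<Rightarrow> 'a set \<Rightarrow> 'b set \<Rightarrow> 'c set \<Rightarrow> ('a, 'b, 'c, 'd) supermap \<Rightarrow>
   ('e \<times> 'a, 'f \<times> 'b, 'e \<times> 'c, 'f \<times> 'd) supermap" where
  "id_tensor_supermap E E' A B C \<Theta> \<equiv> tensor_supermap E E' E A B C (\<lambda>N. N) \<Theta>"

definition CP_preserving ::
  "'a set \<Rightarrow> 'b set \<Rightarrow> 'c set \<Rightarrow> 'd set \<Rightarrow> ('a, 'b, 'c, 'd) supermap \<Rightarrow> bool" where
  "CP_preserving A B C D \<Theta> \<longleftrightarrow> (\<forall>N. CP A B N \<longrightarrow> CP C D (\<Theta> N))"

definition completely_CP_preserving ::
  "'a set \<Rightarrow> 'b set \<Rightarrow> 'c set \<Rightarrow> 'd set \<Rightarrow> ('a, 'b, 'c, 'd) supermap \<Rightarrow> bool" where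
  "completely_CP_preserving A B C D \<Theta> \<longleftrightarrow>
     (\<forall>m>0. \<forall>n>0.
        CP_preserving ({..<m::nat} \<times> A) ({..<n::nat} \<times> B) ({..<m} \<times> C) ({..<n} \<times> D)
          (id_tensor_supermap {..<m} {..<n} A B C \<Theta>))"

definition TP_preserving ::
  "'a set \<Rightarrow> 'b set \<Rightarrow> 'c set \<Rightarrow> 'd set \<Rightarrow> ('a, 'b, 'c, 'd) supermap \<Rightarrow> bool" where
  "TP_preserving A B C D \<Theta> \<longleftrightarrow> (\<forall>N. TP A B N \<longrightarrow> TP C D (\<Theta> N))"

definition superchannel ::
  "'a set \<Rightarrow> 'b set \<Rightarrow> 'c set \<Rightarrow> 'd set \<Rightarrow> ('a, 'b, 'c, 'd) supermap \<Rightarrow> bool" where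
  "superchannel A B C D \<Theta> \<longleftrightarrow>
     \<Theta> \<in> supermaps A B C D \<and> completely_CP_preserving A B C D \<Theta> \<and> TP_preserving A B C D \<Theta>"

definition superchannel_div ::
  "'a set \<Rightarrow> 'b set \<Rightarrow> 'c set \<Rightarrow> 'd set \<Rightarrow>
   ('a, 'b, 'c, 'd) supermap \<Rightarrow> ('a, 'b, 'c, 'd) supermap \<Rightarrow> ereal" where
  "superchannel_div A B C D \<Theta> \<Gamma> =
     (SUP n\<in>{0<..}. SUP N\<in>channels ({..<n::nat} \<times> A) ({..<n} \<times> B).
        channel_div ({..<n} \<times> C) ({..<n} \<times> D)
          (id_tensor_supermap {..<n} {..<n} A B C \<Theta> N)
          (id_tensor_supermap {..<n} {..<n} A B C \<Gamma> N))"


subsection \<open>Entropy of a superchannel\<close>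

definition choi :: "'a set \<Rightarrow> ('a, 'b) omap \<Rightarrow> ('a \<times> 'b) oper" where
  "choi A N = (\<lambda>p q. \<Sum>i\<in>A. \<Sum>j\<in>A. tensor_op (munit i j) (N (munit i j)) p q)"

definition depol_map :: "'c set \<Rightarrow> 'd set \<Rightarrow> ('c, 'd) omap" where
  "depol_map C D = (\<lambda>Y k l. tr C Y * op_id D k l)"

definition depol_supermap ::
  "'a set \<Rightarrow> 'b set \<Rightarrow> 'c set \<Rightarrow> 'd set \<Rightarrow> ('a, 'b, 'c, 'd) supermap" where
  "depol_supermap A B C D = (\<lambda>N Y k l. tr (A \<times> B) (choi A N) * depol_map C D Y k l)"

definition superchannel_entropy ::
  "'a set \<Rightarrow> 'b set \<Rightarrow> 'c set \<Rightarrow> 'd set \<Rightarrow> ('a, 'b, 'c, 'd) supermap \<Rightarrow> ereal" where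
  "superchannel_entropy A B C D \<Theta> =
     - superchannel_div A B C D \<Theta> (depol_supermap A B C D)"


subsection \<open>The defining properties of the tensor products\<close>

text \<open>
  These facts are not needed to state anything: they confirm that \<^const>\<open>tensor_map\<close> and
  \<^const>\<open>tensor_supermap\<close> act factorwise on product arguments, and that
  \<^const>\<open>depol_supermap\<close> of a composite system is the tensor product of those of its parts.
\<close>

lemma lmaps_sum:
  assumes N: "N \<in> lmaps A B" and "finite S"
  shows "N (\<lambda>i j. \<Sum>s\<in>S. c s * F s i j) = (\<lambda>k l. \<Sum>s\<in>S. c s * N (F s) k l)"
  using \<open>finite S\<close>
proof (induction S rule: finite_induct)
  case empty
  have "N (\<lambda>i j. (-1) * 0 + 0) = (\<lambda>k l. (-1) * N (\<lambda>i j. 0) k l + N (\<lambda>i j. 0) k l)"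
    using N by (simp only: lmaps_def mem_Collect_eq)
  then show ?case by simp
next
  case (insert s S)
  have "N (\<lambda>i j. c s * F s i j + (\<Sum>s\<in>S. c s * F s i j)) =
        (\<lambda>k l. c s * N (F s) k l + N (\<lambda>i j. \<Sum>s\<in>S. c s * F s i j) k l)"
    using N by (simp only: lmaps_def mem_Collect_eq)
  then show ?case using insert by simp
qed

lemma lmaps_expand:
  assumes N: "N \<in> lmaps A B" and "finite A"
  shows "N X k l = (\<Sum>(i, j)\<in>A \<times> A. X i j * N (munit i j) k l)"
proof -
  have "compress A X = (\<lambda>r s. \<Sum>p\<in>A \<times> A. X (fst p) (snd p) * munit (fst p) (snd p) r s)"
  proof (intro ext)
    fix r s
    have "(\<Sum>p\<in>A \<times> A. X (fst p) (snd p) * munit (fst p) (snd p) r s) =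
          (\<Sum>p\<in>A \<times> A. if p = (r, s) then X r s else 0)"
      by (intro sum.cong) (auto simp: munit_def)
    then show "compress A X r s = (\<Sum>p\<in>A \<times> A. X (fst p) (snd p) * munit (fst p) (snd p) r s)"
      using \<open>finite A\<close> by (simp add: compress_def)
  qed
  moreover have "N X = N (compress A X)"
    using N by (simp add: lmaps_def)
  ultimately show ?thesis
    using lmaps_sum[OF N, of "A \<times> A" "\<lambda>p. X (fst p) (snd p)" "\<lambda>p. munit (fst p) (snd p)"] \<open>finite A\<close>
    by (simp add: case_prod_unfold)
qed

lemma sum_pairs:
  assumes "finite A" "finite A'"
  shows "(\<Sum>(i, i')\<in>A \<times> A'. \<Sum>(j, j')\<in>B \<times> B'. f i j * g i' j') =
         (\<Sum>(i, j)\<in>A \<times> B. f i j) * ((\<Sum>(i', j')\<in>A' \<times> B'. g i' j') :: complex)"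
proof -
  have "(\<Sum>(i, i')\<in>A \<times> A'. \<Sum>(j, j')\<in>B \<times> B'. f i j * g i' j') =
        (\<Sum>i\<in>A. \<Sum>i'\<in>A'. (\<Sum>j\<in>B. f i j) * (\<Sum>j'\<in>B'. g i' j'))"
    by (simp add: sum.cartesian_product[symmetric] sum_product)
  also have "\<dots> = (\<Sum>i\<in>A. \<Sum>j\<in>B. f i j) * (\<Sum>i'\<in>A'. \<Sum>j'\<in>B'. g i' j')"
    by (simp add: sum_product)
  finally show ?thesis by (simp add: sum.cartesian_product)
qed

lemma sum_swap4:
  "(\<Sum>u\<in>U. \<Sum>x\<in>A. \<Sum>y\<in>B. \<Sum>z\<in>C. \<Sum>w\<in>D. f u x y z w) =
   (\<Sum>x\<in>A. \<Sum>y\<in>B. \<Sum>z\<in>C. \<Sum>w\<in>D. \<Sum>u\<in>U. f u x y z w)"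
  by (simp only: sum.swap[where A = U])

lemma sum_swap_pair:
  "(\<Sum>u\<in>U. \<Sum>v\<in>V. \<Sum>x\<in>A. \<Sum>y\<in>B. \<Sum>z\<in>C. \<Sum>w\<in>D. f u v x y z w) =
   (\<Sum>x\<in>A. \<Sum>y\<in>B. \<Sum>z\<in>C. \<Sum>w\<in>D. \<Sum>u\<in>U. \<Sum>v\<in>V. f u v x y z w)"
proof -
  have "(\<Sum>u\<in>U. \<Sum>v\<in>V. \<Sum>x\<in>A. \<Sum>y\<in>B. \<Sum>z\<in>C. \<Sum>w\<in>D. f u v x y z w) =
        (\<Sum>u\<in>U. \<Sum>x\<in>A. \<Sum>y\<in>B. \<Sum>z\<in>C. \<Sum>w\<in>D. \<Sum>v\<in>V. f u v x y z w)"
    by (intro sum.cong refl) (rule sum_swap4)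
  also have "\<dots> = (\<Sum>x\<in>A. \<Sum>y\<in>B. \<Sum>z\<in>C. \<Sum>w\<in>D. \<Sum>u\<in>U. \<Sum>v\<in>V. f u v x y z w)"
    by (rule sum_swap4)
  finally show ?thesis .
qed

lemma tensor_map_tensor_op:
  assumes N: "N \<in> lmaps A B" and M: "M \<in> lmaps A' B'" and fin: "finite A" "finite A'"
  shows "tensor_map A A' N M (tensor_op X Y) = tensor_op (N X) (M Y)"
proof -
  have "tensor_map A A' N M (tensor_op X Y) (b, b') (d, d') = N X b d * M Y b' d'" for b b' d d'
  proof -
    have "tensor_map A A' N M (tensor_op X Y) (b, b') (d, d') =
          (\<Sum>(i, i')\<in>A \<times> A'. \<Sum>(j, j')\<in>A \<times> A'.
             (X i j * N (munit i j) b d) * (Y i' j' * M (munit i' j') b' d'))"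
      by (simp add: tensor_map_def tensor_op_def mult_ac)
    then show ?thesis
      by (simp add: sum_pairs[OF fin] lmaps_expand[OF N fin(1), of X]
          lmaps_expand[OF M fin(2), of Y])
  qed
  then show ?thesis
    by (simp add: fun_eq_iff tensor_op_def)
qed

lemma tensor_op_munit: "munit (i, i') (j, j') = tensor_op (munit i j) (munit i' j')"
  by (auto simp: munit_def tensor_op_def fun_eq_iff)

lemma munit_apply: "munit i j k l = (if (i, j) = (k, l) then 1 else 0)"
  by (auto simp: munit_def)

lemma map_unit_lmaps: "i \<in> A \<Longrightarrow> j \<in> A \<Longrightarrow> k \<in> B \<Longrightarrow> l \<in> B \<Longrightarrow> map_unit i j k l \<in> lmaps A B"
  by (auto simp: lmaps_def map_unit_def opers_def munit_def compress_def algebra_simps fun_eq_iff)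

lemma supermap_sum:
  assumes \<Theta>: "\<Theta> \<in> supermaps A B C D" and "finite S" and F: "\<And>s. s \<in> S \<Longrightarrow> F s \<in> lmaps A B"
  shows "(\<lambda>X k l. \<Sum>s\<in>S. c s * F s X k l) \<in> lmaps A B \<and>
     \<Theta> (\<lambda>X k l. \<Sum>s\<in>S. c s * F s X k l) = (\<lambda>Y k l. \<Sum>s\<in>S. c s * \<Theta> (F s) Y k l)"
proof -
  have lin: "\<And>c N M. N \<in> lmaps A B \<Longrightarrow> M \<in> lmaps A B \<Longrightarrow>
      \<Theta> (\<lambda>X k l. c * N X k l + M X k l) = (\<lambda>Y k l. c * \<Theta> N Y k l + \<Theta> M Y k l)"
    using \<Theta> by (simp add: supermaps_def)
  show ?thesis
    using \<open>finite S\<close> F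
  proof (induction S rule: finite_induct)
    case empty
    have z: "(\<lambda>X k l. 0) \<in> lmaps A B" by (auto simp: lmaps_def opers_def)
    have "\<Theta> (\<lambda>X k l. (-1) * (\<lambda>X k l. 0) X k l + (\<lambda>X k l. 0) X k l) =
        (\<lambda>Y k l. (-1) * \<Theta> (\<lambda>X k l. 0) Y k l + \<Theta> (\<lambda>X k l. 0) Y k l)"
      by (rule lin[OF z z])
    then show ?case using z by simp
  next
    case (insert s S)
    let ?H = "\<lambda>X k l. \<Sum>s\<in>S. c s * F s X k l"
    have G: "?H \<in> lmaps A B" and Fs: "F s \<in> lmaps A B" using insert by auto
    have "\<Theta> (\<lambda>X k l. c s * F s X k l + ?H X k l) = (\<lambda>Y k l. c s * \<Theta> (F s) Y k l + \<Theta> ?H Y k l)"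
      by (rule lin[OF Fs G])
    moreover have "(\<lambda>X k l. c s * F s X k l + ?H X k l) \<in> lmaps A B"
      using G Fs unfolding lmaps_def opers_def by (simp add: algebra_simps fun_eq_iff)
    ultimately show ?case using insert by simp
  qed
qed

lemma supermap_expand:
  assumes \<Theta>: "\<Theta> \<in> supermaps A B C D" and N: "N \<in> lmaps A B" and fin: "finite A" "finite B"
  shows "\<Theta> N Y r s =
    (\<Sum>(i, j)\<in>A \<times> A. \<Sum>(k, l)\<in>B \<times> B. N (munit i j) k l * \<Theta> (map_unit i j k l) Y r s)"
proof -
  let ?S = "(A \<times> A)\<times>(B \<times> B)"
  let ?c = "\<lambda>s. N (munit (fst (fst s)) (snd (fst s))) (fst (snd s)) (snd (snd s))"
  let ?F = "\<lambda>s. map_unit (fst (fst s)) (snd (fst s)) (fst (snd s)) (snd (snd s))"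
  have NB: "N X k l = 0" if "k \<notin> B \<or> l \<notin> B" for X k l
    using N that by (auto simp: lmaps_def opers_def)
  have Neq: "N = (\<lambda>X k l. \<Sum>s\<in>?S. ?c s * ?F s X k l)"
  proof (intro ext)
    fix X k l
    have in1: "(\<Sum>y\<in>B \<times> B. ?c ((i, j), y) * ?F ((i, j), y) X k l) = X i j * N (munit i j) k l" for i j
    proof -
      have "(\<Sum>y\<in>B \<times> B. ?c ((i, j), y) * ?F ((i, j), y) X k l) =
            (\<Sum>y\<in>B \<times> B. if y = (k, l) then X i j * N (munit i j) k l else 0)"
        by (intro sum.cong)
          (auto simp: map_unit_def munit_apply[of k] munit_apply[of _ _ k l] split: if_splits)
      then show ?thesis using fin NB by auto
    qed
    have "(\<Sum>s\<in>?S. ?c s * ?F s X k l) = (\<Sum>x\<in>A \<times> A. \<Sum>y\<in>B \<times> B. ?c (x, y) * ?F (x, y) X k l)"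
      by (simp only: sum.cartesian_product' fst_conv snd_conv)
    also have "\<dots> = (\<Sum>(i, j)\<in>A \<times> A. X i j * N (munit i j) k l)"
      using in1 by (intro sum.cong) auto
    also have "\<dots> = N X k l" by (rule lmaps_expand[OF N fin(1), symmetric])
    finally show "N X k l = (\<Sum>s\<in>?S. ?c s * ?F s X k l)" by simp
  qed
  have "\<Theta> (\<lambda>X k l. \<Sum>s\<in>?S. ?c s * ?F s X k l) = (\<lambda>Y k l. \<Sum>s\<in>?S. ?c s * \<Theta> (?F s) Y k l)"
    using fin by (intro conjunct2[OF supermap_sum[OF \<Theta>]]) (auto intro: map_unit_lmaps)
  then have "\<Theta> N = (\<lambda>Y k l. \<Sum>s\<in>?S. ?c s * \<Theta> (?F s) Y k l)"
    unfolding Neq[symmetric] .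
  then show ?thesis by (simp add: sum.cartesian_product' case_prod_unfold)
qed

lemma tensor_supermap_tensor_map:
  assumes \<Theta>: "\<Theta> \<in> supermaps A B C D" and \<Gamma>: "\<Gamma> \<in> supermaps A' B' C' D'"
    and N: "N \<in> lmaps A B" and M: "M \<in> lmaps A' B'"
    and fin: "finite A" "finite A'" "finite B" "finite B'" "finite C" "finite C'"
  shows "tensor_supermap A B C A' B' C' \<Theta> \<Gamma> (tensor_map A A' N M) = tensor_map C C' (\<Theta> N) (\<Gamma> M)"
proof -
  have coef: "tensor_map A A' N M (munit x y) z w =
      N (munit (fst x) (fst y)) (fst z) (fst w) * M (munit (snd x) (snd y)) (snd z) (snd w)"
    for x y z w
    using tensor_map_tensor_op[OF N M fin(1,2), of "munit (fst x) (fst y)" "munit (snd x) (snd y)"]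
    by (simp add: tensor_op_munit[symmetric]) (simp add: tensor_op_def case_prod_unfold)
  have "tensor_supermap A B C A' B' C' \<Theta> \<Gamma> (tensor_map A A' N M) Y (b, b') (d, d') =
      tensor_map C C' (\<Theta> N) (\<Gamma> M) Y (b, b') (d, d')" for Y b b' d d'
  proof -
    define t where "t = (\<lambda>m n i j k l. N (munit i j) k l * \<Theta> (map_unit i j k l) (munit m n) b d)"
    define g where "g = (\<lambda>m n i j k l. M (munit i j) k l * \<Gamma> (map_unit i j k l) (munit m n) b' d')"
    have "tensor_map C C' (\<Theta> N) (\<Gamma> M) Y (b, b') (d, d') =
        (\<Sum>u\<in>C \<times> C'. \<Sum>v\<in>C \<times> C'. Y u v *
           (\<Theta> N (munit (fst u) (fst v)) b d * \<Gamma> M (munit (snd u) (snd v)) b' d'))"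
      by (simp add: tensor_map_def tensor_op_def case_prod_unfold)
    also have "\<dots> = (\<Sum>u\<in>C \<times> C'. \<Sum>v\<in>C \<times> C'. Y u v *
        (\<Sum>(i, i')\<in>A \<times> A'. \<Sum>(j, j')\<in>A \<times> A'. \<Sum>(k, k')\<in>B \<times> B'. \<Sum>(l, l')\<in>B \<times> B'.
           t (fst u) (fst v) i j k l * g (snd u) (snd v) i' j' k' l'))"
      unfolding t_def g_def
      using fin by (simp add: supermap_expand[OF \<Theta> N] supermap_expand[OF \<Gamma> M] sum_pairs)
    also have "\<dots> = (\<Sum>(i, i')\<in>A \<times> A'. \<Sum>(j, j')\<in>A \<times> A'. \<Sum>(k, k')\<in>B \<times> B'. \<Sum>(l, l')\<in>B \<times> B'.
        \<Sum>u\<in>C \<times> C'. \<Sum>v\<in>C \<times> C'. Y u v * (t (fst u) (fst v) i j k l * g (snd u) (snd v) i' j' k' l'))"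
      unfolding sum_distrib_left case_prod_unfold by (rule sum_swap_pair)
    also have "\<dots> = tensor_supermap A B C A' B' C' \<Theta> \<Gamma> (tensor_map A A' N M) Y (b, b') (d, d')"
      unfolding tensor_supermap_def tensor_map_def[of C C'] case_prod_unfold sum_distrib_left
      by (intro sum.cong refl) (simp add: coef t_def g_def tensor_op_def)
    finally show ?thesis ..
  qed
  then show ?thesis by (simp add: fun_eq_iff)
qed

lemma tr_choi:
  assumes "finite A" shows "tr (A \<times> B) (choi A N) = (\<Sum>i\<in>A. \<Sum>k\<in>B. N (munit i i) k k)"
proof -
  have "choi A N (r, k) (r, k) = N (munit r r) k k" if "r \<in> A" for r k
  proof -
    have "choi A N (r, k) (r, k) =
        (\<Sum>i\<in>A. \<Sum>j\<in>A. if j = r then if i = r then N (munit r r) k k else 0 else 0)"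
      unfolding choi_def tensor_op_def by (intro sum.cong) (auto simp: munit_apply[of _ _ r r])
    then show ?thesis using assms that by simp
  qed
  then show ?thesis by (simp add: tr_def sum.cartesian_product')
qed

lemma tr_munit: "finite C \<Longrightarrow> tr C (munit i j) = (if i = j \<and> i \<in> C then 1 else 0)"
proof -
  assume "finite C"
  have "tr C (munit i j) = (\<Sum>k\<in>C. if k = i then if i = j then 1 else 0 else 0)"
    unfolding tr_def munit_def by (intro sum.cong) auto
  then show ?thesis using \<open>finite C\<close> by auto
qed

lemma depol_map_tensor:
  assumes "finite C" "finite C'"
  shows "depol_map (C \<times> C') (D \<times> D') = tensor_map C C' (depol_map C D) (depol_map C' D')"
proof (intro ext)
  fix Y p q
  let ?w = "op_id D (fst p) (fst q) * op_id D' (snd p) (snd q)"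
  have "tensor_map C C' (depol_map C D) (depol_map C' D') Y p q =
      (\<Sum>u\<in>C \<times> C'. \<Sum>v\<in>C \<times> C'. if v = u then Y u u * ?w else 0)"
    unfolding tensor_map_def tensor_op_def depol_map_def case_prod_unfold
      tr_munit[OF assms(1)] tr_munit[OF assms(2)]
    by (intro sum.cong refl) (auto simp: prod_eq_iff)
  also have "\<dots> = (\<Sum>u\<in>C \<times> C'. Y u u) * ?w"
    using assms by (simp add: sum_distrib_right)
  also have "?w = op_id (D \<times> D') p q"
    by (auto simp: op_id_def prod_eq_iff mem_Times_iff)
  finally show "depol_map (C \<times> C') (D \<times> D') Y p q =
      tensor_map C C' (depol_map C D) (depol_map C' D') Y p q"
    by (simp add: depol_map_def[of "C \<times> C'"] tr_def[of "C \<times> C'"])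
qed

lemma tr_choi_map_unit:
  assumes "finite A" "finite B"
  shows "tr (A \<times> B) (choi A (map_unit i j k l)) = (if i = j \<and> i \<in> A \<and> k = l \<and> k \<in> B then 1 else 0)"
proof -
  have "tr (A \<times> B) (choi A (map_unit i j k l)) = tr A (munit i j) * tr B (munit k l)"
    unfolding tr_choi[OF assms(1)] unfolding tr_def sum_product map_unit_def
    by (intro sum.cong refl) (auto simp: munit_def)
  then show ?thesis using assms by (cases "i = j"; cases "k = l"; simp add: tr_munit)
qed

lemma depol_supermap_tensor:
  assumes "finite A" "finite A'" "finite B" "finite B'" "finite C" "finite C'"
  shows "depol_supermap (A \<times> A') (B \<times> B') (C \<times> C') (D \<times> D') =
     tensor_supermap A B C A' B' C' (depol_supermap A B C D) (depol_supermap A' B' C' D')"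
proof -
  let ?R = "depol_map (C \<times> C') (D \<times> D')"
  have scale: "tensor_map C C' (depol_supermap A B C D N) (depol_supermap A' B' C' D' M) Y p q =
      tr (A \<times> B) (choi A N) * tr (A' \<times> B') (choi A' M) * ?R Y p q" for N M Y p q
    unfolding depol_map_tensor[OF assms(5,6)] depol_supermap_def tensor_map_def tensor_op_def
    by (simp add: case_prod_unfold sum_distrib_left mult_ac)
  have "tensor_supermap A B C A' B' C' (depol_supermap A B C D) (depol_supermap A' B' C' D') N Y p q =
        depol_supermap (A \<times> A') (B \<times> B') (C \<times> C') (D \<times> D') N Y p q" for N Y p q
  proof -
    have "tensor_supermap A B C A' B' C' (depol_supermap A B C D) (depol_supermap A' B' C' D') N Y p q =
      (\<Sum>x\<in>A \<times> A'. \<Sum>y\<in>A \<times> A'. \<Sum>z\<in>B \<times> B'. \<Sum>w\<in>B \<times> B'.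
        if w = z then if y = x then N (munit x x) z z * ?R Y p q else 0 else 0)"
      unfolding tensor_supermap_def scale case_prod_unfold
        tr_choi_map_unit[OF assms(1,3)] tr_choi_map_unit[OF assms(2,4)]
      by (intro sum.cong refl) (auto simp: prod_eq_iff)
    also have "\<dots> = (\<Sum>x\<in>A \<times> A'. \<Sum>z\<in>B \<times> B'. N (munit x x) z z * ?R Y p q)"
    proof (intro sum.cong refl)
      fix x assume x: "x \<in> A \<times> A'"
      let ?f = "\<lambda>z. N (munit x x) z z * ?R Y p q"
      have "(\<Sum>y\<in>A \<times> A'. \<Sum>z\<in>B \<times> B'. \<Sum>w\<in>B \<times> B'. 
            if w = z then if y = x then ?f z else 0 else 0) =
          (\<Sum>y\<in>A \<times> A'. if y = x then \<Sum>z\<in>B \<times> B'. ?f z else 0)"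
        using assms by (intro sum.cong refl) simp
      then show "(\<Sum>y\<in>A \<times> A'. \<Sum>z\<in>B \<times> B'. \<Sum>w\<in>B \<times> B'. 
            if w = z then if y = x then ?f z else 0 else 0) =
          (\<Sum>z\<in>B \<times> B'. ?f z)"
        using assms x by simp
    qed
    also have "\<dots> = depol_supermap (A \<times> A') (B \<times> B') (C \<times> C') (D \<times> D') N Y p q"
      using assms by (simp add: depol_supermap_def tr_choi sum_distrib_right)
    finally show ?thesis .
  qed
  then show ?thesis by (intro ext) simp
qed

end

theory Submission
  imports Defs
begin

text \<open>
  The divergence of superchannels is superadditive: for channels \<open>N\<close>, \<open>N'\<close> and states \<open>\<rho>\<close>, \<open>\<rho>'\<close>
  that compete in the two suprema, the product channel and the product state, with the reference
  systems merged, compete in the supremum for the tensor product, where they yield the sum of the two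
  relative entropies, because the relative entropy is additive on product operators. The latter is
  read off from the expression of the relative entropy in eigenbases of its arguments. This
  needs the second arguments to be Hermitian only: \<^prop>\<open>ln (x * y) = ln x + ln y\<close> holds for all
  nonzero reals, as \<^const>\<open>ln\<close> is the logarithm of the absolute value.
\<close>

subsection \<open>Spectral theorem\<close>

text \<open>Two features of the definitions shape the work. Reference systems are always of the form
  \<open>{..<n}\<close>, and a composite system carries its labels in the order
  \<open>E \<times> (A \<times> A')\<close>, whereas a product of two competitors lives on
  \<open>(E1 \<times> A) \<times> (E2 \<times> A')\<close>. Products of operators and channels are
  therefore transported along bijections of labels, and maps are compared entry by entry on matrix
  units.

  Additivity also depends on the first arguments having trace one. The trace of one factor is the
  weight with which the entropy of the other is counted, and a factor that does not vanish is what
  lets the support condition of the product split into those of the factors. For this the image of a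
  channel under a superchannel with a reference attached must again preserve the trace, which the
  definition grants only in the absence of a reference. For the second arguments, Hermiticity comes
  from the channel: its Choi operator is Hermitian, and the depolarizing supermap has real symmetric
  coefficients.\<close>

definition orthonormal_on :: "'a set \<Rightarrow> 'k set \<Rightarrow> ('k \<Rightarrow> 'a vect) \<Rightarrow> bool" where
  "orthonormal_on A S u \<longleftrightarrow> (\<forall>k\<in>S. u k \<in> vects A) \<and>
     (\<forall>k\<in>S. \<forall>m\<in>S. inner_on A (u k) (u m) = (if k = m then 1 else 0))"

definition hermitian :: "'a set \<Rightarrow> 'a oper \<Rightarrow> bool" where
  "hermitian A X \<longleftrightarrow> X \<in> opers A \<and> (\<forall>i j. X j i = cnj (X i j))"

section \<open>Inner products and Hermitian operators\<close>

lemma opersD: "X \<in> opers A \<Longrightarrow> i \<notin> A \<or> j \<notin> A \<Longrightarrow> X i j = 0"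
  by (auto simp: opers_def)

lemma inner_on_commute: "inner_on A u v = cnj (inner_on A v u)"
  by (simp add: inner_on_def mult.commute)

lemma inner_on_diff: "inner_on A u (\<lambda>i. v i - w i) = inner_on A u v - inner_on A u w"
  by (simp add: inner_on_def sum_subtractf algebra_simps)

lemma inner_on_add: "inner_on A u (\<lambda>i. v i + w i) = inner_on A u v + inner_on A u w"
  by (simp add: inner_on_def sum.distrib algebra_simps)

lemma inner_on_add_left: "inner_on A (\<lambda>i. v i + w i) u = inner_on A v u + inner_on A w u"
  by (simp add: inner_on_def sum.distrib algebra_simps)

lemma inner_on_scale: "inner_on A u (\<lambda>i. c * v i) = c * inner_on A u v"
  by (simp add: inner_on_def sum_distrib_left mult_ac)

lemma inner_on_scale_left: "inner_on A (\<lambda>i. c * v i) u = cnj c * inner_on A v u"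
  by (simp add: inner_on_def sum_distrib_left mult_ac)

lemma inner_on_sum: "inner_on A u (\<lambda>i. \<Sum>k\<in>S. v k i) = (\<Sum>k\<in>S. inner_on A u (v k))"
  unfolding inner_on_def sum_distrib_left by (rule sum.swap)

lemma inner_on_self: "inner_on A v v = of_real (\<Sum>i\<in>A. (cmod (v i))\<^sup>2)"
  unfolding inner_on_def of_real_sum by (intro sum.cong refl) (metis complex_norm_square mult.commute)

lemma inner_on_self_eq_0:
  assumes "finite A" "v \<in> vects A" "inner_on A v v = 0"
  shows "v = (\<lambda>i. 0)"
proof
  fix i
  have "(\<Sum>i\<in>A. (cmod (v i))\<^sup>2) = 0"
    using assms(3) unfolding inner_on_self by (simp only: of_real_eq_0_iff)
  then have "\<forall>i\<in>A. v i = 0"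
    using \<open>finite A\<close> by (simp add: sum_nonneg_eq_0_iff)
  then show "v i = 0"
    using assms(2) by (cases "i \<in> A") (auto simp: vects_def)
qed

lemma apply_op_vects: "X \<in> opers A \<Longrightarrow> apply_op A X v \<in> vects A"
  by (auto simp: apply_op_def vects_def opers_def)

lemma apply_op_add: "apply_op A X (\<lambda>i. v i + w i) = (\<lambda>i. apply_op A X v i + apply_op A X w i)"
  by (simp add: apply_op_def sum.distrib algebra_simps)

lemma apply_op_scale: "apply_op A X (\<lambda>i. c * v i) = (\<lambda>i. c * apply_op A X v i)"
  by (simp add: apply_op_def sum_distrib_left mult_ac)

lemma hermitian_inner:
  assumes "hermitian A X"
  shows "inner_on A (apply_op A X v) w = inner_on A v (apply_op A X w)"
proof -
  have h: "cnj (X i j) = X j i" for i j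
    using assms unfolding hermitian_def by metis
  have "inner_on A (apply_op A X v) w = (\<Sum>i\<in>A. \<Sum>j\<in>A. cnj (v j) * X j i * w i)"
    by (simp add: inner_on_def apply_op_def sum_distrib_left sum_distrib_right h mult_ac)
  also have "\<dots> = (\<Sum>j\<in>A. \<Sum>i\<in>A. cnj (v j) * X j i * w i)"
    by (rule sum.swap)
  also have "\<dots> = inner_on A v (apply_op A X w)"
    by (simp add: inner_on_def apply_op_def sum_distrib_left mult_ac)
  finally show ?thesis .
qed

text \<open>
  The projections of the standard basis onto the orthogonal complement of \<open>u\<close>. The sum of their
  squared norms is the trace of the projection, which serves as a dimension count.
\<close>

definition residual :: "'k set \<Rightarrow> ('k \<Rightarrow> 'a vect) \<Rightarrow> 'a \<Rightarrow> 'a vect" where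
  "residual S u i = (\<lambda>x. (if x = i then 1 else 0) - (\<Sum>k\<in>S. cnj (u k i) * u k x))"

lemma residual:
  assumes "finite A" "finite S" "orthonormal_on A S u"
  shows residual_vects: "i \<in> A \<Longrightarrow> residual S u i \<in> vects A"
    and residual_orthogonal: "i \<in> A \<Longrightarrow> m \<in> S \<Longrightarrow> inner_on A (u m) (residual S u i) = 0"
    and residual_norm: "i \<in> A \<Longrightarrow>
      inner_on A (residual S u i) (residual S u i) = 1 - (\<Sum>k\<in>S. u k i * cnj (u k i))"
    and residual_sum:
      "(\<Sum>i\<in>A. inner_on A (residual S u i) (residual S u i)) = of_nat (card A) - of_nat (card S)"
proof -
  show v: "residual S u i \<in> vects A" if "i \<in> A" for i
    using assms(3) that by (auto simp: residual_def vects_def orthonormal_on_def intro!: sum.neutral)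
  have e: "inner_on A v (\<lambda>x. if x = i then 1 else 0) = cnj (v i)" if "i \<in> A" for i v
    using that assms(1) unfolding inner_on_def
    by (simp add: if_distrib[of "\<lambda>x. _ * x"] cong: if_cong)
  show o: "inner_on A (u m) (residual S u i) = 0" if "i \<in> A" "m \<in> S" for i m
  proof -
    have "inner_on A (u m) (residual S u i) = cnj (u m i) - (\<Sum>k\<in>S. if k = m then cnj (u m i) else 0)"
      unfolding residual_def inner_on_diff inner_on_sum inner_on_scale e[OF that(1)]
      using assms(3) that(2)
      by (intro arg_cong2[where f = "(-)"] refl sum.cong) (auto simp: orthonormal_on_def)
    then show ?thesis using assms(2) that by simp
  qed
  show n: "inner_on A (residual S u i) (residual S u i) = 1 - (\<Sum>k\<in>S. u k i * cnj (u k i))"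
    if "i \<in> A" for i
  proof -
    have "inner_on A (residual S u i) (residual S u i) = cnj (residual S u i i) -
       (\<Sum>k\<in>S. cnj (u k i) * inner_on A (residual S u i) (u k))"
      by (subst (2) residual_def) (simp add: inner_on_diff inner_on_sum inner_on_scale e[OF that])
    moreover have "inner_on A (residual S u i) (u k) = 0" if "k \<in> S" for k
      using o[OF \<open>i \<in> A\<close> that] inner_on_commute[of A _ "u k"] by simp
    ultimately show ?thesis by (simp add: residual_def)
  qed
  \<comment> \<open>Exchanging the sums turns the total of the subtracted terms into a sum of unit
    norms, that is \<open>card S\<close>.\<close>
  have "(\<Sum>i\<in>A. \<Sum>k\<in>S. u k i * cnj (u k i)) = (\<Sum>k\<in>S. inner_on A (u k) (u k))"
    unfolding inner_on_def by (subst sum.swap) (simp add: mult.commute)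
  also have "\<dots> = (\<Sum>k\<in>S. 1)"
    using assms(3) by (intro sum.cong) (auto simp: orthonormal_on_def)
  finally show "(\<Sum>i\<in>A. inner_on A (residual S u i) (residual S u i)) =
      of_nat (card A) - of_nat (card S)"
    by (simp add: n sum_subtractf)
qed

text \<open>The dimension count: for \<open>card A\<close> orthonormal vectors the squared norms of
  the residuals add up to zero, so every standard basis vector is its own projection. Its components
  give the resolution of the identity.\<close>

lemma orthonormal_complete:
  assumes "finite A" "orthonormal_on A A u" "i \<in> A"
  shows "(\<Sum>k\<in>A. u k x * cnj (u k i)) = (if x = i then 1 else 0)"
proof -
  have "(\<Sum>i\<in>A. \<Sum>x\<in>A. (cmod (residual A u i x))\<^sup>2) = 0"
    using residual_sum[OF assms(1,1,2)] unfolding inner_on_self of_real_sum[symmetric]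
    by (simp only: diff_self of_real_eq_0_iff)
  then have "(\<Sum>x\<in>A. (cmod (residual A u i x))\<^sup>2) = 0"
    using assms(1,3) by (subst (asm) sum_nonneg_eq_0_iff) (auto intro: sum_nonneg)
  then have "residual A u i = (\<lambda>x. 0)"
    by (intro inner_on_self_eq_0[OF assms(1) residual_vects[OF assms(1,1,2,3)]])
      (simp add: inner_on_self)
  from fun_cong[OF this, of x] show ?thesis
    by (simp add: residual_def mult.commute)
qed

text \<open>The same count with fewer than \<open>card A\<close> vectors has a nonzero total, so
  some residual is nonzero; normalised, it is the new vector.\<close>

lemma orthonormal_extend:
  assumes "finite A" "S \<subset> A" "orthonormal_on A S u"
  shows "\<exists>w\<in>vects A. inner_on A w w = 1 \<and> (\<forall>k\<in>S. inner_on A (u k) w = 0)"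
proof -
  have fS: "finite S" using assms(1,2) by (meson finite_subset psubset_imp_subset)
  note r = residual[OF assms(1) fS assms(3)]
  have "card S < card A" by (simp add: assms(1,2) psubset_card_mono)
  then have "(\<Sum>i\<in>A. inner_on A (residual S u i) (residual S u i)) \<noteq> 0"
    unfolding r(4) by simp
  then obtain i where i: "i \<in> A" "inner_on A (residual S u i) (residual S u i) \<noteq> 0"
    by (meson sum.neutral)
  let ?r = "residual S u i"
  define c where "c = (\<Sum>i\<in>A. (cmod (?r i))\<^sup>2)"
  have c: "inner_on A ?r ?r = of_real c" "c > 0"
    using i(2) unfolding inner_on_self c_def[symmetric] less_le of_real_eq_0_iff
    by (auto simp: c_def intro!: sum_nonneg)
  let ?w = "\<lambda>x. of_real (1 / sqrt c) * ?r x"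
  have "inner_on A ?w ?w = of_real (1 / sqrt c * (1 / sqrt c) * c)"
    unfolding inner_on_scale inner_on_scale_left c(1)
    by (simp only: complex_cnj_complex_of_real of_real_mult mult.assoc)
  also have "1 / sqrt c * (1 / sqrt c) * c = 1"
    using c(2) by (simp add: field_simps)
  finally have "inner_on A ?w ?w = 1" by simp
  moreover have "?w \<in> vects A" using r(1)[OF i(1)] by (auto simp: vects_def)
  moreover have "inner_on A (u k) ?w = 0" if "k \<in> S" for k
    unfolding inner_on_scale r(2)[OF i(1) that] by simp
  ultimately show ?thesis by blast
qed

text \<open>Vectors are functions on an arbitrary type, so compactness refers to the product
  topology: the sphere is a closed subset of a product of unit discs over \<open>A\<close> and of
  \<open>{0}\<close> elsewhere, which is compact by Tychonoff's theorem.\<close>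

lemma compact_unit_sphere:
  assumes "finite A"
  shows "compact {v \<in> vects A. inner_on A v v = 1 \<and> (\<forall>k\<in>S. inner_on A (u k) v = 0)}"
proof -
  define K where "K = Pi\<^sub>E UNIV (\<lambda>i. if i \<in> A then cball (0::complex) 1 else {0})"
  have "compactin (product_topology (\<lambda>i. euclidean) UNIV) K"
    unfolding K_def by (subst compactin_PiE) auto
  then have K: "compact K"
    by (simp add: euclidean_product_topology)
  have cl: "closed ({v. inner_on A v v = 1} \<inter> (\<Inter>k\<in>S. {v. inner_on A (u k) v = 0}))"
    by (intro closed_Int closed_INT ballI closed_Collect_eq)
      (auto simp: inner_on_def intro!: continuous_intros continuous_on_product_coordinates)
  have "cmod (v i) \<le> 1" if "inner_on A v v = 1" "i \<in> A" for v i
  proof -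
    have "(\<Sum>i\<in>A. (cmod (v i))\<^sup>2) = 1"
      using that(1) unfolding inner_on_self by (simp only: of_real_eq_1_iff)
    moreover have "(cmod (v i))\<^sup>2 \<le> (\<Sum>i\<in>A. (cmod (v i))\<^sup>2)"
      using assms that(2) by (intro member_le_sum) auto
    ultimately show ?thesis by (simp add: power_le_one_iff)
  qed
  then have "{v \<in> vects A. inner_on A v v = 1 \<and> (\<forall>k\<in>S. inner_on A (u k) v = 0)} =
      K \<inter> ({v. inner_on A v v = 1} \<inter> (\<Inter>k\<in>S. {v. inner_on A (u k) v = 0}))"
    by (auto simp: K_def vects_def PiE_iff split: if_splits)
  then show ?thesis by (simp only: compact_Int_closed[OF K cl])
qed

text \<open>The first-order condition at a minimum, without derivatives. The bound \<open>c\<close>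
  on \<open>\<bar>b\<bar>\<close> is enlarged by one to be positive also for \<open>b = 0\<close>;
  at \<open>t = - a / c\<close> the linear term wins.\<close>

lemma quadratic_nonneg_linear_zero:
  fixes a b :: real
  assumes "\<And>t. 0 \<le> 2 * t * a + t\<^sup>2 * b"
  shows "a = 0"
proof (rule ccontr)
  assume "a \<noteq> 0"
  define c where "c = \<bar>b\<bar> + 1"
  then have "c > 0" by simp
  have "2 * (- a / c) * a + (- a / c)\<^sup>2 * b \<le> 2 * (- a / c) * a + (- a / c)\<^sup>2 * c"
    by (intro add_left_mono mult_left_mono) (auto simp: c_def)
  also have "\<dots> = - a\<^sup>2 / c"
    using \<open>c > 0\<close> by (simp add: field_simps power2_eq_square)
  also have "\<dots> < 0" using \<open>a \<noteq> 0\<close> \<open>c > 0\<close> by simp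
  finally show False using assms[of "- a / c"] by simp
qed

text \<open>
  A maximiser of the quadratic form on the unit sphere of the orthogonal complement is an
  eigenvector, since the complement is invariant.
\<close>

lemma hermitian_eigenvector:
  assumes fin: "finite A" and X: "hermitian A X" and S: "S \<subset> A" and u: "orthonormal_on A S u"
    and ev: "\<And>k. k \<in> S \<Longrightarrow> apply_op A X (u k) = (\<lambda>i. of_real (l k) * u k i)"
  obtains w c where "w \<in> vects A" "inner_on A w w = 1" "\<And>k. k \<in> S \<Longrightarrow> inner_on A (u k) w = 0"
    "apply_op A X w = (\<lambda>i. complex_of_real c * w i)"
proof -
  let ?U = "{v \<in> vects A. inner_on A v v = 1 \<and> (\<forall>k\<in>S. inner_on A (u k) v = 0)}"
  let ?q = "\<lambda>v. Re (inner_on A v (apply_op A X v))"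
  have Xo: "X \<in> opers A" using X unfolding hermitian_def by blast
  have "?U \<noteq> {}" using orthonormal_extend[OF fin S u] by auto
  moreover have "continuous_on ?U ?q"
    unfolding inner_on_def apply_op_def
    by (intro continuous_intros continuous_on_subset[OF continuous_on_product_coordinates]) auto
  ultimately have "\<exists>w\<in>?U. \<forall>v\<in>?U. ?q v \<le> ?q w"
    by (rule continuous_attains_sup[OF compact_unit_sphere[OF fin]])
  then obtain w where w: "w \<in> ?U" and max: "\<And>v. v \<in> ?U \<Longrightarrow> ?q v \<le> ?q w"
    by (elim bexE) (rule that, assumption, erule bspec)
  define c where "c = ?q w"
  \<comment> \<open>Both sides are homogeneous of degree two, so maximality on the sphere extends to
    all vectors of the complement.\<close>
  have bound: "?q v \<le> c * Re (inner_on A v v)"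
    if v: "v \<in> vects A" and orth: "\<And>k. k \<in> S \<Longrightarrow> inner_on A (u k) v = 0" for v
  proof (cases "v = (\<lambda>i. 0)")
    case True
    then show ?thesis by (simp add: inner_on_def)
  next
    case False
    define s where "s = (\<Sum>i\<in>A. (cmod (v i))\<^sup>2)"
    have s: "inner_on A v v = of_real s" by (simp add: inner_on_self s_def)
    have "s \<noteq> 0" using False inner_on_self_eq_0[OF fin v] s by auto
    moreover have "s \<ge> 0" by (simp add: s_def sum_nonneg)
    ultimately have s0: "s > 0" by simp
    let ?v = "\<lambda>i. of_real (1 / sqrt s) * v i"
    have sq: "1 / sqrt s * (1 / sqrt s) = 1 / s" using s0 by (simp add: field_simps)
    have "inner_on A ?v ?v = of_real (1 / sqrt s * (1 / sqrt s) * s)"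
      unfolding inner_on_scale inner_on_scale_left s
      by (simp only: complex_cnj_complex_of_real of_real_mult mult.assoc)
    then have "inner_on A ?v ?v = 1" unfolding sq using s0 by simp
    moreover have "?v \<in> vects A" using v by (auto simp: vects_def)
    moreover have "inner_on A (u k) ?v = 0" if "k \<in> S" for k
      unfolding inner_on_scale orth[OF that] by simp
    ultimately have "?q ?v \<le> c" unfolding c_def by (intro max) auto
    moreover have "inner_on A ?v (apply_op A X ?v) =
        of_real (1 / sqrt s * (1 / sqrt s)) * inner_on A v (apply_op A X v)"
      unfolding apply_op_scale inner_on_scale inner_on_scale_left
      by (simp only: complex_cnj_complex_of_real of_real_mult mult.assoc)
    ultimately have "?q v / s \<le> c" unfolding sq by simp
    then show ?thesis using s s0 by (simp add: field_simps)
  qed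
  \<comment> \<open>The defect of the eigenvalue equation. It lies in the complement again, because
    the \<open>u k\<close> are eigenvectors and \<open>X\<close> can be moved to the other side of
    the inner product; so \<open>w\<close> may be varied in the direction \<open>z\<close>.\<close>
  define z where "z = (\<lambda>i. apply_op A X w i - of_real c * w i)"
  have zv: "z \<in> vects A" using apply_op_vects[OF Xo, of w] w by (auto simp: z_def vects_def)
  have zo: "inner_on A (u k) z = 0" if "k \<in> S" for k
    using w that
    by (simp add: z_def inner_on_diff inner_on_scale hermitian_inner[OF X, symmetric] ev
        inner_on_scale_left)
  have wz: "inner_on A z (apply_op A X w) - of_real c * inner_on A z w = inner_on A z z"
    by (subst (3) z_def) (simp add: inner_on_diff inner_on_scale)
  have wz2: "inner_on A w (apply_op A X z) - of_real c * inner_on A w z = cnj (inner_on A z z)"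
    unfolding wz[symmetric]
    by (simp add: inner_on_commute[symmetric] hermitian_inner[OF X])
  \<comment> \<open>This is \<open>bound\<close> at \<open>w + t z\<close>: the constant terms
    cancel by the choice of \<open>c\<close>, and the linear ones leave the squared norm of
    \<open>z\<close>.\<close>
  have "0 \<le> 2 * t * (- Re (inner_on A z z)) + t\<^sup>2 * (c * Re (inner_on A z z) - ?q z)" for t
  proof -
    let ?v = "\<lambda>i. w i + of_real t * z i"
    have "?q ?v \<le> c * Re (inner_on A ?v ?v)"
    proof (rule bound)
      show "?v \<in> vects A" using w zv by (auto simp: vects_def)
      show "inner_on A (u k) ?v = 0" if "k \<in> S" for k
        unfolding inner_on_add inner_on_scale using zo that w by simp
    qed
    moreover have "?q ?v = c + t * (Re (inner_on A w (apply_op A X z)) +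
        Re (inner_on A z (apply_op A X w))) + t\<^sup>2 * ?q z"
      unfolding apply_op_add apply_op_scale inner_on_add inner_on_scale inner_on_add_left
        inner_on_scale_left
      by (simp add: c_def power2_eq_square distrib_left)
    moreover have "Re (inner_on A ?v ?v) = 1 + t * (Re (inner_on A w z) + Re (inner_on A z w)) +
        t\<^sup>2 * Re (inner_on A z z)"
      using w unfolding inner_on_add inner_on_scale inner_on_add_left inner_on_scale_left
      by (simp add: power2_eq_square distrib_left)
    moreover have "Re (inner_on A w (apply_op A X z)) = Re (inner_on A z z) + c * Re (inner_on A w z)"
      using arg_cong[OF wz2, of Re] by simp
    moreover have "Re (inner_on A z (apply_op A X w)) = Re (inner_on A z z) + c * Re (inner_on A z w)"
      using arg_cong[OF wz, of Re] by simp
    \<comment> \<open>The rearrangement is isolated for arbitrary reals, so that the preceding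
      equations enter by rewriting alone.\<close>
    moreover have "0 \<le> 2 * t * (- r) + s * (c * r - e)"
      if "c + t * ((r + c * p) + (r + c * q)) + s * e \<le> c * (1 + t * (p + q) + s * r)"
      for r p q s e :: real
      using that by (simp add: algebra_simps)
    ultimately show ?thesis by (simp only:)
  qed
  from quadratic_nonneg_linear_zero[OF this] have "Re (inner_on A z z) = 0" by simp
  then have "inner_on A z z = 0" by (simp add: inner_on_self)
  then have "z = (\<lambda>i. 0)" by (rule inner_on_self_eq_0[OF fin zv])
  then have "apply_op A X w = (\<lambda>i. complex_of_real c * w i)"
    by (simp add: z_def fun_eq_iff)
  then show ?thesis using that w by blast
qed

text \<open>Eigenvectors are attached to the labels in \<open>A\<close> one at a time, which gives a
  basis indexed by \<open>A\<close> as the definition demands. Inserting the resolution of the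
  identity to the right of \<open>X\<close> then turns the eigenvalue equations into the
  decomposition.\<close>

lemma spectral_theorem:
  assumes fin: "finite A" and X: "hermitian A X"
  obtains u l where "spectral_decomposition A X u l"
proof -
  have "\<exists>u l. orthonormal_on A S u \<and>
      (\<forall>k\<in>S. apply_op A X (u k) = (\<lambda>i. complex_of_real (l k) * u k i))" if "S \<subseteq> A" for S
    using finite_subset[OF that fin] that
  proof (induction S rule: finite_induct)
    case empty
    show ?case by (simp add: orthonormal_on_def)
  next
    case (insert s S)
    then obtain u l where u: "orthonormal_on A S u"
      and l: "\<And>k. k \<in> S \<Longrightarrow> apply_op A X (u k) = (\<lambda>i. complex_of_real (l k) * u k i)"
      by auto
    have "S \<subset> A" using insert by auto
    from hermitian_eigenvector[OF fin X this u l] obtain w c where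
      w: "w \<in> vects A" "inner_on A w w = 1" "\<And>k. k \<in> S \<Longrightarrow> inner_on A (u k) w = 0"
        "apply_op A X w = (\<lambda>i. complex_of_real c * w i)" by blast
    have "inner_on A w (u k) = 0" if "k \<in> S" for k
      using w(3)[OF that] inner_on_commute[of A w] by simp
    then have "orthonormal_on A (insert s S) (u(s := w))"
      using u w insert.hyps by (auto simp: orthonormal_on_def)
    moreover have "\<forall>k\<in>insert s S. apply_op A X ((u(s := w)) k) =
        (\<lambda>i. complex_of_real ((l(s := c)) k) * (u(s := w)) k i)"
      using l w(4) insert.hyps by auto
    ultimately show ?case by blast
  qed
  from this[OF subset_refl] obtain u l where u: "orthonormal_on A A u"
    and l: "\<And>k. k \<in> A \<Longrightarrow> apply_op A X (u k) = (\<lambda>i. complex_of_real (l k) * u k i)" by blast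
  have "X i j = (\<Sum>k\<in>A. of_real (l k) * u k i * cnj (u k j))" for i j
  proof (cases "j \<in> A")
    case False
    have "X i j = 0" using X False opersD unfolding hermitian_def by metis
    moreover have "u k j = 0" if "k \<in> A" for k
      using u False that by (auto simp: orthonormal_on_def vects_def)
    ultimately show ?thesis by simp
  next
    case True
    have "X i j = (\<Sum>m\<in>A. X i m * (\<Sum>k\<in>A. u k m * cnj (u k j)))"
      using fin True
      by (simp add: orthonormal_complete[OF fin u True] if_distrib[of "\<lambda>x. _ * x"] cong: if_cong)
    also have "\<dots> = (\<Sum>k\<in>A. apply_op A X (u k) i * cnj (u k j))"
      unfolding sum_distrib_left apply_op_def sum_distrib_right
      by (subst sum.swap) (simp add: mult_ac)
    finally show ?thesis using l by simp
  qed
  then have "spectral_decomposition A X u l"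
    using u by (simp add: spectral_decomposition_def orthonormal_on_def fun_eq_iff)
  then show ?thesis by (rule that)
qed


subsection \<open>Relative entropy in eigenbases\<close>

lemma spectral_orthonormal: "spectral_decomposition A X u l \<Longrightarrow> orthonormal_on A A u"
  by (simp add: spectral_decomposition_def orthonormal_on_def)

lemma inner_expand:
  assumes "finite A" "orthonormal_on A A u"
  shows "inner_on A w v = (\<Sum>k\<in>A. inner_on A w (u k) * inner_on A (u k) v)"
proof -
  have "(\<Sum>k\<in>A. inner_on A w (u k) * inner_on A (u k) v) =
      (\<Sum>k\<in>A. \<Sum>j\<in>A. \<Sum>i\<in>A. cnj (w i) * v j * (u k i * cnj (u k j)))"
    unfolding inner_on_def sum_product
    by (rule sum.cong[OF refl], subst sum.swap) (simp add: mult_ac)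
  also have "\<dots> = (\<Sum>j\<in>A. \<Sum>k\<in>A. \<Sum>i\<in>A. cnj (w i) * v j * (u k i * cnj (u k j)))"
    by (rule sum.swap)
  also have "\<dots> = (\<Sum>j\<in>A. \<Sum>i\<in>A. cnj (w i) * v j * (\<Sum>k\<in>A. u k i * cnj (u k j)))"
    unfolding sum_distrib_left by (rule sum.cong[OF refl], rule sum.swap)
  also have "\<dots> = (\<Sum>j\<in>A. \<Sum>i\<in>A. if i = j then cnj (w i) * v j else 0)"
    by (intro sum.cong refl) (simp add: orthonormal_complete[OF assms])
  also have "\<dots> = inner_on A w v"
    using assms(1) by (simp add: inner_on_def)
  finally show ?thesis ..
qed

lemma parseval:
  assumes "finite A" "orthonormal_on A A u"
  shows "(\<Sum>k\<in>A. (cmod (inner_on A v (u k)))\<^sup>2) = Re (inner_on A v v)"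
proof -
  have "inner_on A v v = (\<Sum>k\<in>A. of_real ((cmod (inner_on A v (u k)))\<^sup>2))"
    by (subst inner_expand[OF assms], intro sum.cong refl, subst (2) inner_on_commute)
      (simp only: complex_norm_square)
  then show ?thesis by simp
qed

lemma apply_spectral:
  assumes "spectral_decomposition A X u l"
  shows "apply_op A X v i = (\<Sum>k\<in>A. of_real (l k) * inner_on A (u k) v * u k i)"
proof -
  have "apply_op A X v i = (\<Sum>j\<in>A. \<Sum>k\<in>A. of_real (l k) * u k i * cnj (u k j) * v j)"
    using assms by (simp add: spectral_decomposition_def apply_op_def sum_distrib_right)
  also have "\<dots> = (\<Sum>k\<in>A. of_real (l k) * inner_on A (u k) v * u k i)"
    unfolding inner_on_def sum_distrib_left sum_distrib_right
    by (subst sum.swap) (simp add: mult_ac)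
  finally show ?thesis .
qed

lemma inner_spectral:
  assumes "finite A" "spectral_decomposition A X u l" "k \<in> A"
  shows "inner_on A (u k) (apply_op A X v) = of_real (l k) * inner_on A (u k) v"
proof -
  have "inner_on A (u k) (apply_op A X v) =
      (\<Sum>m\<in>A. if m = k then of_real (l k) * inner_on A (u k) v else 0)"
    using assms(2,3)
    unfolding apply_spectral[OF assms(2), abs_def] inner_on_sum inner_on_scale
    by (intro sum.cong) (auto simp: spectral_decomposition_def)
  then show ?thesis using assms(1,3) by simp
qed

lemma apply_spectral_basis:
  assumes "finite A" "spectral_decomposition A X u l" "k \<in> A"
  shows "apply_op A X (u k) = (\<lambda>i. of_real (l k) * u k i)"
proof
  fix i
  have "apply_op A X (u k) i = (\<Sum>m\<in>A. if m = k then of_real (l k) * u k i else 0)"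
    using assms(2,3) unfolding apply_spectral[OF assms(2)]
    by (intro sum.cong) (auto simp: spectral_decomposition_def)
  then show "apply_op A X (u k) i = of_real (l k) * u k i" using assms(1,3) by simp
qed

lemma kernel_spectral:
  assumes fin: "finite A" and X: "spectral_decomposition A X u l"
  shows "w \<in> kernel A X \<longleftrightarrow> w \<in> vects A \<and> (\<forall>k\<in>A. l k \<noteq> 0 \<longrightarrow> inner_on A (u k) w = 0)"
proof -
  have "apply_op A X w = (\<lambda>i. 0) \<longleftrightarrow> (\<forall>k\<in>A. l k \<noteq> 0 \<longrightarrow> inner_on A (u k) w = 0)"
  proof
    assume a: "apply_op A X w = (\<lambda>i. 0)"
    show "\<forall>k\<in>A. l k \<noteq> 0 \<longrightarrow> inner_on A (u k) w = 0"
    proof (intro ballI impI)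
      fix k assume "k \<in> A" "l k \<noteq> 0"
      then show "inner_on A (u k) w = 0"
        using inner_spectral[OF fin X, of k w] by (simp add: a inner_on_def[of _ _ "\<lambda>i. 0"])
    qed
  next
    assume "\<forall>k\<in>A. l k \<noteq> 0 \<longrightarrow> inner_on A (u k) w = 0"
    then show "apply_op A X w = (\<lambda>i. 0)"
      by (intro ext) (auto simp: apply_spectral[OF X] intro!: sum.neutral)
  qed
  then show ?thesis by (auto simp: kernel_def)
qed

text \<open>The kernel is spanned by the \<open>u k\<close> with \<open>l k = 0\<close>, so
  orthogonality to these alone characterises the support.\<close>

lemma supp_spectral:
  assumes fin: "finite A" and X: "spectral_decomposition A X u l"
  shows "v \<in> supp A X \<longleftrightarrow> v \<in> vects A \<and> (\<forall>k\<in>A. l k = 0 \<longrightarrow> inner_on A (u k) v = 0)"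
proof (intro iffI conjI)
  assume v: "v \<in> supp A X"
  then show "v \<in> vects A" by (simp add: supp_def)
  show "\<forall>k\<in>A. l k = 0 \<longrightarrow> inner_on A (u k) v = 0"
  proof (intro ballI impI)
    fix k assume k: "k \<in> A" "l k = 0"
    have "u k \<in> kernel A X"
      using spectral_orthonormal[OF X] k by (auto simp: kernel_spectral[OF assms] orthonormal_on_def)
    then show "inner_on A (u k) v = 0" using v by (simp add: supp_def)
  qed
next
  assume v: "v \<in> vects A \<and> (\<forall>k\<in>A. l k = 0 \<longrightarrow> inner_on A (u k) v = 0)"
  have "inner_on A w v = 0" if w: "w \<in> kernel A X" for w
  proof -
    have "inner_on A w (u k) * inner_on A (u k) v = 0" if "k \<in> A" for k
      using w v that inner_on_commute[of A w "u k"]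
      by (cases "l k = 0") (auto simp: kernel_spectral[OF assms])
    then show ?thesis
      unfolding inner_expand[OF fin spectral_orthonormal[OF X], of w v] by (intro sum.neutral) auto
  qed
  then show "v \<in> supp A X" using v by (simp add: supp_def)
qed

text \<open>The support of \<open>X\<close> is spanned by the \<open>u k\<close> with nonzero
  eigenvalue, that of \<open>Y\<close> is the complement of the \<open>v j\<close> with eigenvalue
  zero. This reduces the inclusion to overlaps of eigenvectors, which are multiplicative on
  products.\<close>

lemma supp_subset_spectral:
  assumes fin: "finite A" and X: "spectral_decomposition A X u l"
    and Y: "spectral_decomposition A Y v m"
  shows "supp A X \<subseteq> supp A Y \<longleftrightarrow>
    (\<forall>k\<in>A. \<forall>j\<in>A. l k \<noteq> 0 \<longrightarrow> m j = 0 \<longrightarrow> inner_on A (u k) (v j) = 0)"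
proof
  assume sub: "supp A X \<subseteq> supp A Y"
  show "\<forall>k\<in>A. \<forall>j\<in>A. l k \<noteq> 0 \<longrightarrow> m j = 0 \<longrightarrow> inner_on A (u k) (v j) = 0"
  proof (intro ballI impI)
    fix k j assume k: "k \<in> A" "l k \<noteq> 0" and j: "j \<in> A" "m j = 0"
    have "u k \<in> supp A X"
      using spectral_orthonormal[OF X] k
      by (auto simp: supp_spectral[OF fin X] orthonormal_on_def)
    then have "inner_on A (v j) (u k) = 0"
      using sub j supp_spectral[OF fin Y] by blast
    then show "inner_on A (u k) (v j) = 0" using inner_on_commute[of A "u k"] by simp
  qed
next
  assume c: "\<forall>k\<in>A. \<forall>j\<in>A. l k \<noteq> 0 \<longrightarrow> m j = 0 \<longrightarrow> inner_on A (u k) (v j) = 0"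
  show "supp A X \<subseteq> supp A Y"
  proof
    fix w assume "w \<in> supp A X"
    then have w: "w \<in> vects A" "\<And>k. k \<in> A \<Longrightarrow> l k = 0 \<Longrightarrow> inner_on A (u k) w = 0"
      by (auto simp: supp_spectral[OF fin X])
    have "inner_on A (v j) w = 0" if "j \<in> A" "m j = 0" for j
    proof -
      have "inner_on A (v j) (u k) * inner_on A (u k) w = 0" if "k \<in> A" for k
        using w(2) c that \<open>j \<in> A\<close> \<open>m j = 0\<close> inner_on_commute[of A "v j" "u k"]
        by (cases "l k = 0") auto
      then show ?thesis
        unfolding inner_expand[OF fin spectral_orthonormal[OF X], of "v j" w]
        by (intro sum.neutral) auto
    qed
    then show "w \<in> supp A Y" using w(1) by (simp add: supp_spectral[OF fin Y])
  qed
qed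

text \<open>Expanding the conjugated factor in a second basis brings operators that are diagonal in
  different bases into a common form.\<close>

lemma rank_one_sum_expand:
  fixes F :: "'a \<Rightarrow> complex"
  assumes "finite A" "orthonormal_on A A u" "orthonormal_on A A v"
  shows "(\<Sum>k\<in>A. F k * u k i * cnj (u k j)) =
         (\<Sum>k\<in>A. \<Sum>n\<in>A. F k * inner_on A (u k) (v n) * u k i * cnj (v n j))"
proof -
  have "cnj (u k j) = (\<Sum>n\<in>A. inner_on A (u k) (v n) * cnj (v n j))" if k: "k \<in> A" for k
  proof (cases "j \<in> A")
    case False
    have "u k j = 0" "\<And>n. n \<in> A \<Longrightarrow> v n j = 0"
      using assms(2,3) k False by (auto simp: orthonormal_on_def vects_def)
    then show ?thesis by simp
  next
    case True
    have "(\<Sum>n\<in>A. inner_on A (u k) (v n) * cnj (v n j)) =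
        (\<Sum>x\<in>A. cnj (u k x) * (\<Sum>n\<in>A. v n x * cnj (v n j)))"
      unfolding inner_on_def sum_distrib_left sum_distrib_right
      by (subst sum.swap) (simp add: mult_ac)
    also have "\<dots> = (\<Sum>x\<in>A. if x = j then cnj (u k x) else 0)"
      by (intro sum.cong refl) (simp add: orthonormal_complete[OF assms(1,3) True])
    finally show ?thesis using True assms(1) by simp
  qed
  then show ?thesis
    by (intro sum.cong refl) (simp add: sum_distrib_left mult_ac)
qed

text \<open>The definite description is well defined: for two decompositions of the same operator,
  evaluating it between \<open>u k\<close> and \<open>v n\<close> shows that these vectors are
  orthogonal unless \<open>l k = m n\<close>. So \<open>f (l k)\<close> and \<open>f (m n)\<close>
  agree wherever the overlap does not vanish.\<close>

lemma op_fun_spectral: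
  assumes fin: "finite A" and X: "spectral_decomposition A X u l"
  shows "op_fun A f X = (\<lambda>i j. \<Sum>k\<in>A. of_real (f (l k)) * u k i * cnj (u k j))"
  unfolding op_fun_def
proof (rule the_equality)
  show "\<exists>v m. spectral_decomposition A X v m \<and>
      (\<lambda>i j. \<Sum>k\<in>A. complex_of_real (f (l k)) * u k i * cnj (u k j)) =
      (\<lambda>i j. \<Sum>k\<in>A. of_real (f (m k)) * v k i * cnj (v k j))"
    using X by blast
next
  fix F
  assume "\<exists>v m. spectral_decomposition A X v m \<and>
      F = (\<lambda>i j. \<Sum>k\<in>A. complex_of_real (f (m k)) * v k i * cnj (v k j))"
  then obtain v m where Y: "spectral_decomposition A X v m"
    and F: "F = (\<lambda>i j. \<Sum>k\<in>A. complex_of_real (f (m k)) * v k i * cnj (v k j))" by blast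
  note o = spectral_orthonormal[OF X] spectral_orthonormal[OF Y]
  show "F = (\<lambda>i j. \<Sum>k\<in>A. complex_of_real (f (l k)) * u k i * cnj (u k j))"
  proof (intro ext)
    fix i j
    have eq: "of_real (f (m n)) * inner_on A (u k) (v n) = of_real (f (l k)) * inner_on A (u k) (v n)"
      if "k \<in> A" "n \<in> A" for k n
    proof -
      have "of_real (l k) * inner_on A (u k) (v n) = of_real (m n) * inner_on A (u k) (v n)"
        using inner_spectral[OF fin X that(1), of "v n"]
        unfolding apply_spectral_basis[OF fin Y that(2)] inner_on_scale by (rule sym)
      then show ?thesis by (metis mult_cancel_right of_real_eq_iff)
    qed
    \<comment> \<open>The expansion acts on the conjugated factor, whereas here the other one has to
      change basis; hence it is applied to the entry \<open>j\<close>, \<open>i\<close> and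
      conjugated.\<close>
    have "cnj (F i j) = (\<Sum>n\<in>A. \<Sum>k\<in>A. of_real (f (m n)) * inner_on A (v n) (u k) * v n j * cnj (u k i))"
      using rank_one_sum_expand[OF fin o(2,1), of "\<lambda>k. of_real (f (m k))" j i]
      by (simp add: F mult_ac)
    then have "F i j = cnj (\<Sum>n\<in>A. \<Sum>k\<in>A. of_real (f (m n)) * inner_on A (v n) (u k) * v n j * cnj (u k i))"
      by (metis complex_cnj_cnj)
    also have "\<dots> = (\<Sum>n\<in>A. \<Sum>k\<in>A. of_real (f (m n)) * inner_on A (u k) (v n) * u k i * cnj (v n j))"
      unfolding cnj_sum by (intro sum.cong refl) (simp add: inner_on_commute[symmetric])
    also have "\<dots> = (\<Sum>k\<in>A. \<Sum>n\<in>A. of_real (f (l k)) * inner_on A (u k) (v n) * u k i * cnj (v n j))"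
      by (subst sum.swap) (intro sum.cong refl, simp add: eq)
    finally show "F i j = (\<Sum>k\<in>A. complex_of_real (f (l k)) * u k i * cnj (u k j))"
      using rank_one_sum_expand[OF fin o, of "\<lambda>k. of_real (f (l k))" i j] by simp
  qed
qed

lemma tr_rank_one_sums:
  "tr A (op_mult A (\<lambda>i j. \<Sum>k\<in>A. F k * u k i * cnj (u k j))
                   (\<lambda>i j. \<Sum>n\<in>A. G n * v n i * cnj (v n j))) =
   (\<Sum>k\<in>A. \<Sum>n\<in>A. F k * G n * of_real ((cmod (inner_on A (u k) (v n)))\<^sup>2))"
proof -
  have "tr A (op_mult A (\<lambda>i j. \<Sum>k\<in>A. F k * u k i * cnj (u k j))
                   (\<lambda>i j. \<Sum>n\<in>A. G n * v n i * cnj (v n j))) =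
    (\<Sum>i\<in>A. \<Sum>j\<in>A. \<Sum>k\<in>A. \<Sum>n\<in>A. F k * G n * (cnj (u k j) * v n j) * (u k i * cnj (v n i)))"
    unfolding tr_def op_mult_def sum_product by (simp add: mult_ac)
  also have "\<dots> = (\<Sum>i\<in>A. \<Sum>k\<in>A. \<Sum>n\<in>A. \<Sum>j\<in>A. F k * G n * (cnj (u k j) * v n j) * (u k i * cnj (v n i)))"
    by (rule sum.cong[OF refl], subst sum.swap, rule sum.cong[OF refl], rule sum.swap)
  also have "\<dots> = (\<Sum>k\<in>A. \<Sum>n\<in>A. \<Sum>i\<in>A. \<Sum>j\<in>A. F k * G n * (cnj (u k j) * v n j) * (u k i * cnj (v n i)))"
    by (subst sum.swap, rule sum.cong[OF refl], rule sum.swap)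
  also have "\<dots> = (\<Sum>k\<in>A. \<Sum>n\<in>A. F k * G n * (inner_on A (u k) (v n) * cnj (inner_on A (u k) (v n))))"
    unfolding inner_on_def cnj_sum sum_product unfolding sum_distrib_left
    by (rule sum.cong[OF refl], rule sum.cong[OF refl], subst sum.swap) (simp add: mult_ac)
  finally show ?thesis unfolding complex_norm_square .
qed

text \<open>By Parseval, the squared overlaps of an eigenvector of \<open>X\<close> with the
  eigenbasis of \<open>Y\<close> add up to one, so the term \<open>l k * ln (l k)\<close> can be
  spread over \<open>j\<close>. The result is the Nussbaum-Szkola form: the classical relative
  entropy of the weights \<open>l k\<close> and \<open>m j\<close>, each multiplied by the squared
  overlap.\<close>

lemma rel_entropy_spectral:
  assumes fin: "finite A" and X: "spectral_decomposition A X u l"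
    and Y: "spectral_decomposition A Y v m"
  shows "rel_entropy A X Y =
    (if \<forall>k\<in>A. \<forall>j\<in>A. l k \<noteq> 0 \<longrightarrow> m j = 0 \<longrightarrow> inner_on A (u k) (v j) = 0
     then ereal (\<Sum>k\<in>A. \<Sum>j\<in>A. l k * (ln (l k) - ln (m j)) * (cmod (inner_on A (u k) (v j)))\<^sup>2)
     else \<infinity>)"
proof -
  note o = spectral_orthonormal[OF X] spectral_orthonormal[OF Y]
  have Xeq: "X = (\<lambda>i j. \<Sum>k\<in>A. of_real (l k) * u k i * cnj (u k j))"
    using X by (simp add: spectral_decomposition_def)
  have split: "tr A (op_mult A X (\<lambda>i j. F i j - G i j)) = tr A (op_mult A X F) - tr A (op_mult A X G)"
    for F G by (simp add: tr_def op_mult_def right_diff_distrib sum_subtractf)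
  have W: "(\<Sum>j\<in>A. (cmod (inner_on A (u k) (v j)))\<^sup>2) = 1"
    "(\<Sum>j\<in>A. (cmod (inner_on A (u k) (u j)))\<^sup>2 * c j) = c k" if "k \<in> A" for k c
  proof -
    show "(\<Sum>j\<in>A. (cmod (inner_on A (u k) (v j)))\<^sup>2) = 1"
      using o(1) that by (simp add: parseval[OF fin o(2)] orthonormal_on_def)
    have "(\<Sum>j\<in>A. (cmod (inner_on A (u k) (u j)))\<^sup>2 * c j) = (\<Sum>j\<in>A. if j = k then c k else 0)"
      using o(1) that by (intro sum.cong) (auto simp: orthonormal_on_def)
    then show "(\<Sum>j\<in>A. (cmod (inner_on A (u k) (u j)))\<^sup>2 * c j) = c k"
      using that fin by simp
  qed
  have "Re (tr A (op_mult A X (\<lambda>i j. op_log A X i j - op_log A Y i j))) =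
      (\<Sum>k\<in>A. \<Sum>j\<in>A. l k * ln (l j) * (cmod (inner_on A (u k) (u j)))\<^sup>2) -
      (\<Sum>k\<in>A. \<Sum>j\<in>A. l k * ln (m j) * (cmod (inner_on A (u k) (v j)))\<^sup>2)"
    unfolding split unfolding op_log_def op_fun_spectral[OF fin X] op_fun_spectral[OF fin Y]
    by (subst (1 2) Xeq) (simp add: tr_rank_one_sums)
  also have "(\<Sum>k\<in>A. \<Sum>j\<in>A. l k * ln (l j) * (cmod (inner_on A (u k) (u j)))\<^sup>2) =
      (\<Sum>k\<in>A. l k * (\<Sum>j\<in>A. (cmod (inner_on A (u k) (u j)))\<^sup>2 * ln (l j)))"
    by (simp add: sum_distrib_left mult_ac)
  also have "\<dots> = (\<Sum>k\<in>A. l k * ln (l k) * (\<Sum>j\<in>A. (cmod (inner_on A (u k) (v j)))\<^sup>2))"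
    by (intro sum.cong refl) (simp add: W)
  also have "\<dots> - (\<Sum>k\<in>A. \<Sum>j\<in>A. l k * ln (m j) * (cmod (inner_on A (u k) (v j)))\<^sup>2) =
      (\<Sum>k\<in>A. \<Sum>j\<in>A. l k * (ln (l k) - ln (m j)) * (cmod (inner_on A (u k) (v j)))\<^sup>2)"
    by (simp add: sum_distrib_left sum_subtractf algebra_simps)
  finally show ?thesis
    unfolding rel_entropy_def supp_subset_spectral[OF assms] by (simp only:)
qed

section \<open>Product operators and additivity of the relative entropy\<close>

lemma tr_spectral:
  assumes "spectral_decomposition A X u l"
  shows "tr A X = of_real (\<Sum>k\<in>A. l k)"
proof -
  have "tr A X = (\<Sum>i\<in>A. \<Sum>k\<in>A. of_real (l k) * (cnj (u k i) * u k i))"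
    using assms by (simp add: tr_def spectral_decomposition_def mult_ac)
  also have "\<dots> = (\<Sum>k\<in>A. of_real (l k) * inner_on A (u k) (u k))"
    unfolding inner_on_def sum_distrib_left by (rule sum.swap)
  also have "\<dots> = (\<Sum>k\<in>A. of_real (l k))"
    using assms by (intro sum.cong) (auto simp: spectral_decomposition_def)
  finally show ?thesis by simp
qed

text \<open>The congruence by the linear map that sends the basis vector \<open>z\<close> to
  \<open>g z\<close>. For bijective \<open>g\<close> it only renames the basis; the cut-off outside
  \<open>Z\<close> keeps the result in \<open>opers Z\<close>.\<close>

definition pull_op :: "'b set \<Rightarrow> ('b \<Rightarrow> 'a) \<Rightarrow> 'a oper \<Rightarrow> 'b oper" where
  "pull_op Z g X = (\<lambda>z w. if z \<in> Z \<and> w \<in> Z then X (g z) (g w) else 0)"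

lemma sum_bij_pairs:
  assumes "bij_betw g Z (P \<times> Q)"
  shows "(\<Sum>z\<in>Z. F (fst (g z)) (snd (g z))) = (\<Sum>p\<in>P. \<Sum>q\<in>Q. F p q)"
  using sum.reindex_bij_betw[OF assms, of "\<lambda>p. F (fst p) (snd p)"]
  by (simp add: sum.cartesian_product')

lemma inner_on_product:
  assumes "bij_betw g Z (P \<times> Q)"
  shows "inner_on Z (\<lambda>w. if w \<in> Z then u (fst (g w)) * u' (snd (g w)) else 0)
      (\<lambda>w. if w \<in> Z then v (fst (g w)) * v' (snd (g w)) else 0) =
    inner_on P u v * inner_on Q u' v'"
proof -
  have "inner_on Z (\<lambda>w. if w \<in> Z then u (fst (g w)) * u' (snd (g w)) else 0)
      (\<lambda>w. if w \<in> Z then v (fst (g w)) * v' (snd (g w)) else 0) =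
    (\<Sum>z\<in>Z. (cnj (u (fst (g z))) * v (fst (g z))) * (cnj (u' (snd (g z))) * v' (snd (g z))))"
    unfolding inner_on_def by (intro sum.cong) (auto simp: mult_ac)
  also have "\<dots> = inner_on P u v * inner_on Q u' v'"
    unfolding inner_on_def sum_product by (rule sum_bij_pairs[OF assms])
  finally show ?thesis .
qed

definition product_basis :: "'c set \<Rightarrow> ('c \<Rightarrow> 'a \<times> 'b) \<Rightarrow> ('a \<Rightarrow> 'a vect) \<Rightarrow> ('b \<Rightarrow> 'b vect) \<Rightarrow> 'c \<Rightarrow> 'c vect" where
  "product_basis Z g u u' = (\<lambda>z w. if w \<in> Z then u (fst (g z)) (fst (g w)) * u' (snd (g z)) (snd (g w)) else 0)"

text \<open>Products of eigenvectors are eigenvectors. Their pairs of indices are read through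
  \<open>g\<close>, so that the eigenbasis is indexed by \<open>Z\<close> itself.\<close>

lemma spectral_product:
  assumes g: "bij_betw g Z (P \<times> Q)"
    and X: "spectral_decomposition P X u l" and X': "spectral_decomposition Q X' u' l'"
  shows "spectral_decomposition Z (pull_op Z g (tensor_op X X')) (product_basis Z g u u')
    (\<lambda>z. l (fst (g z)) * l' (snd (g z)))"
proof -
  have gZ: "fst (g z) \<in> P" "snd (g z) \<in> Q" if "z \<in> Z" for z
    using bij_betwE[OF g] that by (auto simp: mem_Times_iff)
  have inj: "z = w" if "z \<in> Z" "w \<in> Z" "fst (g z) = fst (g w)" "snd (g z) = snd (g w)" for z w
    using g that by (auto simp: bij_betw_def inj_on_def prod_eq_iff)
  have "inner_on Z (product_basis Z g u u' z) (product_basis Z g u u' w) = (if z = w then 1 else 0)"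
    if "z \<in> Z" "w \<in> Z" for z w
    using X X' gZ[OF that(1)] gZ[OF that(2)] inj[OF that]
    unfolding product_basis_def inner_on_product[OF g]
    by (auto simp: spectral_decomposition_def)
  moreover have "product_basis Z g u u' z \<in> vects Z" for z
    by (simp add: product_basis_def vects_def)
  moreover have "pull_op Z g (tensor_op X X') i j = (\<Sum>z\<in>Z. complex_of_real (l (fst (g z)) * l' (snd (g z))) *
      product_basis Z g u u' z i * cnj (product_basis Z g u u' z j))" for i j
  proof (cases "i \<in> Z \<and> j \<in> Z")
    case True
    have "(\<Sum>z\<in>Z. complex_of_real (l (fst (g z)) * l' (snd (g z))) *
        product_basis Z g u u' z i * cnj (product_basis Z g u u' z j)) =
      (\<Sum>z\<in>Z. (of_real (l (fst (g z))) * u (fst (g z)) (fst (g i)) * cnj (u (fst (g z)) (fst (g j)))) *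
        (of_real (l' (snd (g z))) * u' (snd (g z)) (snd (g i)) * cnj (u' (snd (g z)) (snd (g j)))))"
      using True by (intro sum.cong) (auto simp: product_basis_def)
    also have "\<dots> = X (fst (g i)) (fst (g j)) * X' (snd (g i)) (snd (g j))"
      using X X' unfolding spectral_decomposition_def
      by (subst sum_bij_pairs[OF g]) (simp add: sum_product)
    finally show ?thesis using True by (simp add: pull_op_def tensor_op_def case_prod_unfold)
  qed (auto simp: pull_op_def product_basis_def)
  ultimately show ?thesis by (simp add: spectral_decomposition_def fun_eq_iff)
qed

text \<open>Eigenvalues and squared overlaps multiply and the logarithm splits, so each summand
  becomes two, in which the other factor contributes only its weights. These add up to one: over the
  overlaps by Parseval, over the eigenvalues by the trace condition.\<close>

lemma rel_entropy_product:
  assumes fin: "finite P" "finite Q" and g: "bij_betw g Z (P \<times> Q)"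
    and herm: "hermitian P X" "hermitian P Y" "hermitian Q X'" "hermitian Q Y'"
    and tr: "tr P X = 1" "tr Q X' = 1"
  shows "rel_entropy Z (pull_op Z g (tensor_op X X')) (pull_op Z g (tensor_op Y Y')) =
    rel_entropy P X Y + rel_entropy Q X' Y'"
proof -
  obtain u l where X: "spectral_decomposition P X u l" using spectral_theorem[OF fin(1) herm(1)] .
  obtain v m where Y: "spectral_decomposition P Y v m" using spectral_theorem[OF fin(1) herm(2)] .
  obtain u' l' where X': "spectral_decomposition Q X' u' l'" using spectral_theorem[OF fin(2) herm(3)] .
  obtain v' m' where Y': "spectral_decomposition Q Y' v' m'" using spectral_theorem[OF fin(2) herm(4)] .
  have finZ: "finite Z" using g fin by (simp add: bij_betw_finite)
  have gZ: "g ` Z = P \<times> Q" using g by (simp add: bij_betw_def)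
  define w where "w = (\<lambda>k j. (cmod (inner_on P (u k) (v j)))\<^sup>2)"
  define w' where "w' = (\<lambda>k j. (cmod (inner_on Q (u' k) (v' j)))\<^sup>2)"
  have l1: "(\<Sum>k\<in>P. l k) = 1" "(\<Sum>k\<in>Q. l' k) = 1"
    using tr by (simp_all only: tr_spectral[OF X] tr_spectral[OF X'] of_real_eq_1_iff)
  have w1: "(\<Sum>j\<in>P. w k j) = 1" if "k \<in> P" for k
    using X that unfolding w_def parseval[OF fin(1) spectral_orthonormal[OF Y]]
    by (simp add: spectral_decomposition_def)
  have w1': "(\<Sum>j\<in>Q. w' k j) = 1" if "k \<in> Q" for k
    using X' that unfolding w'_def parseval[OF fin(2) spectral_orthonormal[OF Y']]
    by (simp add: spectral_decomposition_def)
  let ?c = "\<forall>k\<in>P. \<forall>j\<in>P. l k \<noteq> 0 \<longrightarrow> m j = 0 \<longrightarrow> w k j = 0"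
  let ?c' = "\<forall>k\<in>Q. \<forall>j\<in>Q. l' k \<noteq> 0 \<longrightarrow> m' j = 0 \<longrightarrow> w' k j = 0"
  let ?s = "\<Sum>k\<in>P. \<Sum>j\<in>P. l k * (ln (l k) - ln (m j)) * w k j"
  let ?s' = "\<Sum>k\<in>Q. \<Sum>j\<in>Q. l' k * (ln (l' k) - ln (m' j)) * w' k j"
  have D: "rel_entropy P X Y = (if ?c then ereal ?s else \<infinity>)"
    unfolding rel_entropy_spectral[OF fin(1) X Y] w_def power_eq_0_iff norm_eq_zero by simp
  have D': "rel_entropy Q X' Y' = (if ?c' then ereal ?s' else \<infinity>)"
    unfolding rel_entropy_spectral[OF fin(2) X' Y'] w'_def power_eq_0_iff norm_eq_zero by simp
  define L where "L = (\<lambda>z. l (fst (g z)) * l' (snd (g z)))"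
  define M where "M = (\<lambda>z. m (fst (g z)) * m' (snd (g z)))"
  define W where "W = (\<lambda>z y. w (fst (g z)) (fst (g y)) * w' (snd (g z)) (snd (g y)))"
  let ?C = "\<forall>z\<in>Z. \<forall>y\<in>Z. L z \<noteq> 0 \<longrightarrow> M y = 0 \<longrightarrow> W z y = 0"
  let ?S = "\<Sum>z\<in>Z. \<Sum>y\<in>Z. L z * (ln (L z) - ln (M y)) * W z y"
  have Weq: "(cmod (inner_on Z (product_basis Z g u u' z) (product_basis Z g v v' y)))\<^sup>2 = W z y" for z y
    by (simp add: product_basis_def inner_on_product[OF g] W_def w_def w'_def norm_mult power_mult_distrib)
  have Weq0: "inner_on Z (product_basis Z g u u' z) (product_basis Z g v v' y) = 0 \<longleftrightarrow> W z y = 0" for z y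
    unfolding Weq[symmetric] by simp
  have DD: "rel_entropy Z (pull_op Z g (tensor_op X X')) (pull_op Z g (tensor_op Y Y')) =
      (if ?C then ereal ?S else \<infinity>)"
    unfolding rel_entropy_spectral[OF finZ spectral_product[OF g X X'] spectral_product[OF g Y Y']]
      Weq Weq0 unfolding L_def M_def ..
  have C: "?C \<longleftrightarrow> (\<forall>k\<in>P. \<forall>k'\<in>Q. \<forall>j\<in>P. \<forall>j'\<in>Q.
      l k * l' k' \<noteq> 0 \<longrightarrow> m j * m' j' = 0 \<longrightarrow> w k j * w' k' j' = 0)"
  proof -
    have "(\<forall>z\<in>Z. \<forall>y\<in>Z. R (g z) (g y)) \<longleftrightarrow> (\<forall>x\<in>P\<times>Q. \<forall>y\<in>P\<times>Q. R x y)" for R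
      unfolding gZ[symmetric] by blast
    from this[of "\<lambda>x y. l (fst x) * l' (snd x) \<noteq> 0 \<longrightarrow> m (fst y) * m' (snd y) = 0 \<longrightarrow>
        w (fst x) (fst y) * w' (snd x) (snd y) = 0"]
    show ?thesis unfolding L_def M_def W_def by auto
  qed
  \<comment> \<open>Normalisation provides indices of nonzero weight in either factor. Substituted
    into the support condition of the product, they isolate the condition of the other
    factor.\<close>
  obtain k0 where k0: "k0 \<in> P" "l k0 \<noteq> 0" using l1(1) by (metis sum.neutral zero_neq_one)
  obtain k0' where k0': "k0' \<in> Q" "l' k0' \<noteq> 0" using l1(2) by (metis sum.neutral zero_neq_one)
  obtain j0 where j0: "j0 \<in> P" "w k0 j0 \<noteq> 0" using w1[OF k0(1)] by (metis sum.neutral zero_neq_one)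
  obtain j0' where j0': "j0' \<in> Q" "w' k0' j0' \<noteq> 0" using w1'[OF k0'(1)] by (metis sum.neutral zero_neq_one)
  have CC: "?C \<longleftrightarrow> ?c \<and> ?c'"
  proof
    assume a: "?C"
    have "w k j = 0" if "k \<in> P" "j \<in> P" "l k \<noteq> 0" "m j = 0" for k j
      using a[unfolded C, rule_format, OF that(1) k0'(1) that(2) j0'(1)] that k0' j0' by simp
    moreover have "w' k j = 0" if "k \<in> Q" "j \<in> Q" "l' k \<noteq> 0" "m' j = 0" for k j
      using a[unfolded C, rule_format, OF k0(1) that(1) j0(1) that(2)] that k0 j0 by simp
    ultimately show "?c \<and> ?c'" by blast
  next
    assume "?c \<and> ?c'"
    then show "?C" unfolding C mult_eq_0_iff by blast
  qed
  have S: "?S = ?s + ?s'" if c: "?c" "?c'"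
  proof -
    have "?S = (\<Sum>k\<in>P. \<Sum>k'\<in>Q. \<Sum>j\<in>P. \<Sum>j'\<in>Q.
        l k * l' k' * (ln (l k * l' k') - ln (m j * m' j')) * (w k j * w' k' j'))"
      unfolding L_def M_def W_def by (subst sum_bij_pairs[OF g], subst sum_bij_pairs[OF g]) (rule refl)
    also have "\<dots> = (\<Sum>k\<in>P. \<Sum>k'\<in>Q. \<Sum>j\<in>P. \<Sum>j'\<in>Q.
        (l k * (ln (l k) - ln (m j)) * w k j) * (l' k' * w' k' j') +
        (l k * w k j) * (l' k' * (ln (l' k') - ln (m' j')) * w' k' j'))"
    proof (intro sum.cong refl)
      fix k k' j j' assume i: "k \<in> P" "k' \<in> Q" "j \<in> P" "j' \<in> Q"
      show "l k * l' k' * (ln (l k * l' k') - ln (m j * m' j')) * (w k j * w' k' j') =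
        (l k * (ln (l k) - ln (m j)) * w k j) * (l' k' * w' k' j') +
        (l k * w k j) * (l' k' * (ln (l' k') - ln (m' j')) * w' k' j')"
      \<comment> \<open>A summand of weight zero vanishes on both sides, whatever the logarithms
        are. In all others the support conditions make \<open>m j\<close> and \<open>m' j'\<close>
        nonzero, and the logarithm of the product splits.\<close>
      proof (cases "l k = 0 \<or> l' k' = 0 \<or> w k j = 0 \<or> w' k' j' = 0")
        case False
        then have "m j \<noteq> 0" "m' j' \<noteq> 0" using c i by blast+
        then show ?thesis using False by (simp add: ln_mult algebra_simps)
      qed auto
    qed
    also have "\<dots> = (\<Sum>k\<in>P. \<Sum>k'\<in>Q. (\<Sum>j\<in>P. l k * (ln (l k) - ln (m j)) * w k j) * (l' k' * (\<Sum>j'\<in>Q. w' k' j')) +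
        (l k * (\<Sum>j\<in>P. w k j)) * (\<Sum>j'\<in>Q. l' k' * (ln (l' k') - ln (m' j')) * w' k' j'))"
      unfolding sum.distrib sum_distrib_left[of "l _"] sum_distrib_left[of "l' _"] sum_product ..
    also have "\<dots> = (\<Sum>k\<in>P. \<Sum>k'\<in>Q. (\<Sum>j\<in>P. l k * (ln (l k) - ln (m j)) * w k j) * l' k' +
        l k * (\<Sum>j'\<in>Q. l' k' * (ln (l' k') - ln (m' j')) * w' k' j'))"
      by (intro sum.cong refl) (simp add: w1 w1')
    also have "\<dots> = ?s * (\<Sum>k\<in>Q. l' k) + (\<Sum>k\<in>P. l k) * ?s'"
      unfolding sum.distrib sum_product ..
    finally show ?thesis using l1 by simp
  qed
  show ?thesis
  proof (cases "?C")
    case True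
    then have c: "?c" "?c'" using CC by blast+
    show ?thesis unfolding DD D D' if_P[OF True] if_P[OF c(1)] if_P[OF c(2)] S[OF c] by simp
  next
    case False
    then have "\<not> ?c \<or> \<not> ?c'" using CC by blast
    then show ?thesis unfolding DD D D' if_not_P[OF False] by auto
  qed
qed


subsection \<open>Positivity and channels\<close>

lemma positive_spectral:
  assumes fin: "finite A" and X: "spectral_decomposition A X u l"
  shows "positive A X \<longleftrightarrow> (\<forall>k\<in>A. l k \<ge> 0)"
proof
  assume p: "positive A X"
  show "\<forall>k\<in>A. l k \<ge> 0"
  proof
    fix k assume k: "k \<in> A"
    have "inner_on A (u k) (apply_op A X (u k)) \<in> \<real>\<^sub>\<ge>\<^sub>0"
      using p X k by (auto simp: positive_def spectral_decomposition_def)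
    moreover have "inner_on A (u k) (apply_op A X (u k)) = of_real (l k)"
      using X k unfolding inner_spectral[OF fin X k] by (simp add: spectral_decomposition_def)
    ultimately show "l k \<ge> 0" by simp
  qed
next
  assume l: "\<forall>k\<in>A. l k \<ge> 0"
  note o = spectral_orthonormal[OF X]
  have "X \<in> opers A"
    using X o by (auto simp: spectral_decomposition_def orthonormal_on_def opers_def vects_def)
  moreover have "inner_on A v (apply_op A X v) \<in> \<real>\<^sub>\<ge>\<^sub>0" for v
  proof -
    have "inner_on A v (apply_op A X v) = (\<Sum>k\<in>A. of_real (l k * (cmod (inner_on A v (u k)))\<^sup>2))"
      unfolding inner_expand[OF fin o, of v "apply_op A X v"] of_real_mult complex_norm_square
      by (intro sum.cong refl) (simp add: inner_spectral[OF fin X] inner_on_commute[symmetric])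
    moreover have "(\<Sum>k\<in>A. l k * (cmod (inner_on A v (u k)))\<^sup>2) \<ge> 0"
      using l by (intro sum_nonneg) auto
    ultimately show ?thesis by (simp only: of_real_sum[symmetric] nonneg_Reals_of_real_iff)
  qed
  ultimately show "positive A X" by (simp add: positive_def)
qed

text \<open>Polarisation: the quadratic form is real at the basis vectors \<open>i\<close> and
  \<open>j\<close>, the latter multiplied by \<open>c\<close>, and at their sum, so the two cross
  terms have a real sum.\<close>

lemma positive_hermitian:
  assumes fin: "finite A" and X: "positive A X"
  shows "hermitian A X"
  unfolding hermitian_def
proof (intro conjI allI)
  show o: "X \<in> opers A" using X by (simp add: positive_def)
  fix i j
  show "X j i = cnj (X i j)"
  proof (cases "i \<in> A \<and> j \<in> A")
    case True
    let ?e = "\<lambda>i x. if x = i then (1::complex) else 0"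
    let ?b = "\<lambda>u v. inner_on A u (apply_op A X v)"
    have b: "?b (?e i) (?e j) = X i j" if "i \<in> A" "j \<in> A" for i j
      using that fin by (simp add: inner_on_def apply_op_def if_distrib[of "\<lambda>x. _ * x"]
          if_distrib[of "\<lambda>x. x * _"] if_distrib[of cnj] cong: if_cong)
    have re: "Im (?b v v) = 0" if "v \<in> vects A" for v
      using X that by (auto simp: positive_def nonneg_Reals_def)
    have *: "Im (c * ?b (?e i) (?e j)) + Im (cnj c * ?b (?e j) (?e i)) = 0" for c
    proof -
      have v: "?e i \<in> vects A" "(\<lambda>x. c * ?e j x) \<in> vects A" "(\<lambda>x. ?e i x + c * ?e j x) \<in> vects A"
        using True by (auto simp: vects_def)
      have "?b (\<lambda>x. ?e i x + c * ?e j x) (\<lambda>x. ?e i x + c * ?e j x) =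
          ?b (?e i) (?e i) + c * ?b (?e i) (?e j) +
          (cnj c * ?b (?e j) (?e i) + ?b (\<lambda>x. c * ?e j x) (\<lambda>x. c * ?e j x))"
        unfolding apply_op_add apply_op_scale inner_on_add inner_on_scale inner_on_add_left
          inner_on_scale_left by (simp only: distrib_left add_ac mult_ac)
      from arg_cong[OF this, of Im] show ?thesis
        unfolding plus_complex.simps re[OF v(1)] re[OF v(2)] re[OF v(3)] by simp
    qed
    \<comment> \<open>The choice \<open>c = 1\<close> relates the imaginary parts,
      \<open>c = \<i>\<close> the real parts.\<close>
    have "Im (X i j) + Im (X j i) = 0" "Re (X i j) - Re (X j i) = 0"
      using *[of 1] *[of \<i>] True unfolding b[OF True[THEN conjunct1] True[THEN conjunct2]]
        b[OF True[THEN conjunct2] True[THEN conjunct1]] by simp_all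
    then show ?thesis by (simp add: complex_eq_iff)
  qed (use o in \<open>auto simp: opers_def\<close>)
qed

text \<open>A congruence preserves positivity. The map \<open>g\<close> may identify labels, which
  is why vectors are pushed forward by sums over fibres.\<close>

lemma positive_pull:
  assumes fin: "finite Z" "finite A" and g: "g ` Z \<subseteq> A" and X: "positive A X"
  shows "positive Z (pull_op Z g X)"
  unfolding positive_def
proof (intro conjI ballI)
  show "pull_op Z g X \<in> opers Z" by (auto simp: pull_op_def opers_def)
  fix v assume "v \<in> vects Z"
  \<comment> \<open>The image of \<open>v\<close> under the linear map sending the basis vector
    \<open>z\<close> to \<open>g z\<close>; the two quadratic forms agree at \<open>v\<close> and
    \<open>w\<close>.\<close>
  define w where "w = (\<lambda>a. \<Sum>z\<in>{z \<in> Z. g z = a}. v z)"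
  have "w a = 0" if "a \<notin> A" for a
    using g that unfolding w_def by (intro sum.neutral) auto
  then have w: "w \<in> vects A" by (simp add: vects_def)
  have grp: "(\<Sum>a\<in>A. F a * w a) = (\<Sum>z\<in>Z. F (g z) * v z)" for F
  proof -
    have "(\<Sum>a\<in>A. F a * w a) = (\<Sum>a\<in>A. \<Sum>z\<in>{z \<in> Z. g z = a}. F (g z) * v z)"
      unfolding w_def sum_distrib_left by (intro sum.cong refl) auto
    also have "\<dots> = (\<Sum>z\<in>Z. F (g z) * v z)" by (rule sum.group[OF fin g])
    finally show ?thesis .
  qed
  have grp': "(\<Sum>a\<in>A. cnj (w a) * F a) = (\<Sum>z\<in>Z. cnj (v z) * F (g z))" for F
    using arg_cong[OF grp[of "\<lambda>a. cnj (F a)"], of cnj] by (simp add: mult.commute)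
  have "inner_on Z v (apply_op Z (pull_op Z g X) v) =
      (\<Sum>z\<in>Z. cnj (v z) * (\<Sum>y\<in>Z. X (g z) (g y) * v y))"
    unfolding inner_on_def apply_op_def pull_op_def by (intro sum.cong refl) simp
  also have "\<dots> = (\<Sum>z\<in>Z. cnj (v z) * apply_op A X w (g z))"
    unfolding apply_op_def grp ..
  also have "\<dots> = inner_on A w (apply_op A X w)"
    unfolding inner_on_def grp' ..
  finally show "inner_on Z v (apply_op Z (pull_op Z g X) v) \<in> \<real>\<^sub>\<ge>\<^sub>0"
    using X w by (simp add: positive_def)
qed

lemma states_product:
  assumes fin: "finite P" "finite Q" and g: "bij_betw g Z (P \<times> Q)"
    and \<rho>: "\<rho> \<in> states P" "\<rho>' \<in> states Q"
  shows "pull_op Z g (tensor_op \<rho> \<rho>') \<in> states Z"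
proof -
  have p: "positive P \<rho>" "positive Q \<rho>'" and t: "tr P \<rho> = 1" "tr Q \<rho>' = 1"
    using \<rho> by (auto simp: states_def)
  have finZ: "finite Z" using g fin by (simp add: bij_betw_finite)
  have gZ: "fst (g z) \<in> P" "snd (g z) \<in> Q" if "z \<in> Z" for z
    using bij_betwE[OF g] that by (auto simp: mem_Times_iff)
  obtain u l where X: "spectral_decomposition P \<rho> u l"
    using spectral_theorem[OF fin(1) positive_hermitian[OF fin(1) p(1)]] .
  obtain u' l' where X': "spectral_decomposition Q \<rho>' u' l'"
    using spectral_theorem[OF fin(2) positive_hermitian[OF fin(2) p(2)]] .
  have "positive Z (pull_op Z g (tensor_op \<rho> \<rho>'))"
    unfolding positive_spectral[OF finZ spectral_product[OF g X X']]
    using p gZ unfolding positive_spectral[OF fin(1) X] positive_spectral[OF fin(2) X'] by simp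
  moreover have "tr Z (pull_op Z g (tensor_op \<rho> \<rho>')) =
      (\<Sum>z\<in>Z. \<rho> (fst (g z)) (fst (g z)) * \<rho>' (snd (g z)) (snd (g z)))"
    unfolding tr_def pull_op_def tensor_op_def case_prod_unfold by (intro sum.cong) auto
  then have "tr Z (pull_op Z g (tensor_op \<rho> \<rho>')) = tr P \<rho> * tr Q \<rho>'"
    using sum_bij_pairs[OF g, of "\<lambda>p q. \<rho> p p * \<rho>' q q"] by (simp add: tr_def sum_product)
  ultimately show ?thesis using t by (simp add: states_def)
qed

section \<open>Maps tensored with the identity on a reference\<close>

lemma tensor_map_munit:
  assumes "finite A" "finite A'" "x \<in> A \<times> A'" "y \<in> A \<times> A'"
  shows "tensor_map A A' N M (munit x y) p q =
    N (munit (fst x) (fst y)) (fst p) (fst q) * M (munit (snd x) (snd y)) (snd p) (snd q)"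
proof -
  have "tensor_map A A' N M (munit x y) p q =
      (\<Sum>u\<in>A \<times> A'. \<Sum>v\<in>A \<times> A'. if v = y then if u = x then
        N (munit (fst x) (fst y)) (fst p) (fst q) * M (munit (snd x) (snd y)) (snd p) (snd q) else 0 else 0)"
    unfolding tensor_map_def tensor_op_def case_prod_unfold
    by (intro sum.cong refl) (auto simp: munit_def)
  then show ?thesis using assms by simp
qed

lemma tensor_map_opers:
  assumes "\<And>i j. N (munit i j) \<in> opers B" "\<And>i j. M (munit i j) \<in> opers B'"
  shows "tensor_map A A' N M X \<in> opers (B \<times> B')"
  using assms unfolding tensor_map_def tensor_op_def case_prod_unfold opers_def
  by (auto simp: mem_Times_iff intro!: sum.neutral)

text \<open>The identity factor passes the reference labels of an entry through, so \<open>N\<close>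
  acts on each block separately. Later computations with references start from this form.\<close>

lemma id_tensor_map_apply:
  assumes "finite E" "finite A"
  shows "id_tensor_map E A N X p q = (if fst p \<in> E \<and> fst q \<in> E then
    \<Sum>i\<in>A. \<Sum>j\<in>A. X (fst p, i) (fst q, j) * N (munit i j) (snd p) (snd q) else 0)"
proof -
  have "id_tensor_map E A N X p q = (\<Sum>r\<in>E. \<Sum>i\<in>A. \<Sum>s\<in>E. \<Sum>j\<in>A.
      if s = fst q then if r = fst p \<and> fst p \<in> E \<and> fst q \<in> E then X (fst p, i) (fst q, j) * N (munit i j) (snd p) (snd q) else 0 else 0)"
    unfolding tensor_map_def tensor_op_def case_prod_unfold sum.cartesian_product'
    by (intro sum.cong refl) (auto simp: compress_def munit_def)
  also have "\<dots> = (\<Sum>r\<in>E. if r = fst p then \<Sum>i\<in>A. \<Sum>s\<in>E. if s = fst q then \<Sum>j\<in>A.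
      X (fst p, i) (fst q, j) * N (munit i j) (snd p) (snd q) else 0 else 0)"
    by (intro sum.cong refl) (auto intro!: sum.cong sum.neutral)
  also have "\<dots> = (if fst p \<in> E \<and> fst q \<in> E then
    \<Sum>i\<in>A. \<Sum>j\<in>A. X (fst p, i) (fst q, j) * N (munit i j) (snd p) (snd q) else 0)"
    using assms by simp
  finally show ?thesis .
qed

text \<open>Complete positivity is defined with the references \<open>{..<n}\<close>, but composite
  references arise below. An enumeration \<open>e\<close> of \<open>E\<close> carries the operator
  to such a reference and its inverse \<open>f\<close> carries the image back.\<close>

lemma CP_positive:
  assumes N: "CP A B N" and fin: "finite E" "finite A" "finite B" and "E \<noteq> {}"
    and X: "positive (E \<times> A) X"
  shows "positive (E \<times> B) (id_tensor_map E A N X)"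
proof -
  obtain e where e: "bij_betw e {..<card E} E"
    using ex_bij_betw_nat_finite[OF fin(1)] by (auto simp: atLeast0LessThan)
  define n where "n = card E"
  have n: "n > 0" using fin(1) \<open>E \<noteq> {}\<close> by (simp add: n_def card_gt_0_iff)
  define f where "f = inv_into {..<n} e"
  have f: "f x \<in> {..<n}" "e (f x) = x" if "x \<in> E" for x
    using e that unfolding f_def n_def
    by (auto simp: bij_betw_def inv_into_into f_inv_into_f) (metis imageI inv_into_into lessThan_iff)
  have e': "e r \<in> E" if "r \<in> {..<n}" for r using e that unfolding n_def by (metis bij_betwE)
  let ?X = "pull_op ({..<n} \<times> A) (\<lambda>p. (e (fst p), snd p)) X"
  have "positive ({..<n} \<times> A) ?X"
    using fin e' by (intro positive_pull[OF _ _ _ X]) auto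
  then have "positive ({..<n} \<times> B) (id_tensor_map {..<n} A N ?X)"
    using N n by (simp add: CP_def)
  then have "positive (E \<times> B) (pull_op (E \<times> B) (\<lambda>p. (f (fst p), snd p)) (id_tensor_map {..<n} A N ?X))"
    using fin f by (intro positive_pull[where A = "{..<n} \<times> B"]) auto
  moreover have "pull_op (E \<times> B) (\<lambda>p. (f (fst p), snd p)) (id_tensor_map {..<n} A N ?X) =
      id_tensor_map E A N X"
  proof (intro ext)
    fix p q
    show "pull_op (E \<times> B) (\<lambda>p. (f (fst p), snd p)) (id_tensor_map {..<n} A N ?X) p q =
      id_tensor_map E A N X p q"
    proof (cases "p \<in> E \<times> B \<and> q \<in> E \<times> B")
      case True
      then have pq: "fst p \<in> E" "fst q \<in> E" by auto
      have "pull_op (E \<times> B) (\<lambda>p. (f (fst p), snd p)) (id_tensor_map {..<n} A N ?X) p q =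
          (\<Sum>i\<in>A. \<Sum>j\<in>A. ?X (f (fst p), i) (f (fst q), j) * N (munit i j) (snd p) (snd q))"
        using True f[OF pq(1)] f[OF pq(2)] fin by (simp add: pull_op_def id_tensor_map_apply)
      also have "\<dots> = (\<Sum>i\<in>A. \<Sum>j\<in>A. X (fst p, i) (fst q, j) * N (munit i j) (snd p) (snd q))"
        using f[OF pq(1)] f[OF pq(2)] by (intro sum.cong refl) (simp add: pull_op_def)
      finally show ?thesis using pq fin by (simp add: id_tensor_map_apply)
    next
      case False
      have "N Y k l = 0" if "k \<notin> B \<or> l \<notin> B" for Y k l
        using N that by (auto simp: CP_def lmaps_def opers_def)
      then have "id_tensor_map E A N X p q = 0"
        using False fin unfolding id_tensor_map_apply[OF fin(1,2)]
        by (auto simp: mem_Times_iff intro!: sum.neutral)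
      then show ?thesis using False by (auto simp: pull_op_def[of "E \<times> B"])
    qed
  qed
  ultimately show ?thesis by (simp only:)
qed

text \<open>The form in which a completely positive map is applied to one factor of a larger system:
  \<open>g\<close> assembles a label of \<open>Z\<close> from reference and input, and
  \<open>h\<close> splits a label of \<open>W\<close> into reference and output. The operator is a
  pull-back along \<open>g\<close>, followed by the map with reference and a pull-back along
  \<open>h\<close>.\<close>

lemma CP_positive_relabel:
  assumes N: "CP A B N" and fin: "finite E" "finite A" "finite B" "finite Z" "finite W" and "E \<noteq> {}"
    and X: "positive Z X" and g: "\<And>e a. e \<in> E \<Longrightarrow> a \<in> A \<Longrightarrow> g (e, a) \<in> Z"
    and h: "\<And>w. w \<in> W \<Longrightarrow> h w \<in> E \<times> B"
  shows "positive W (\<lambda>w w'. if w \<in> W \<and> w' \<in> W then \<Sum>i\<in>A. \<Sum>j\<in>A.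
    X (g (fst (h w), i)) (g (fst (h w'), j)) * N (munit i j) (snd (h w)) (snd (h w')) else 0)"
proof -
  have "positive (E \<times> A) (pull_op (E \<times> A) g X)"
    using fin g by (intro positive_pull[OF _ _ _ X]) auto
  from CP_positive[OF N fin(1-3) \<open>E \<noteq> {}\<close> this]
  have "positive W (pull_op W h (id_tensor_map E A N (pull_op (E \<times> A) g X)))"
    using fin h by (intro positive_pull[where A = "E \<times> B"] image_subsetI) auto
  also have "pull_op W h (id_tensor_map E A N (pull_op (E \<times> A) g X)) =
    (\<lambda>w w'. if w \<in> W \<and> w' \<in> W then \<Sum>i\<in>A. \<Sum>j\<in>A.
    X (g (fst (h w), i)) (g (fst (h w'), j)) * N (munit i j) (snd (h w)) (snd (h w')) else 0)"
  proof (intro ext)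
    fix w w'
    show "pull_op W h (id_tensor_map E A N (pull_op (E \<times> A) g X)) w w' = 
      (if w \<in> W \<and> w' \<in> W then \<Sum>i\<in>A. \<Sum>j\<in>A.
      X (g (fst (h w), i)) (g (fst (h w'), j)) * N (munit i j) (snd (h w)) (snd (h w')) else 0)"
      using h[of w] h[of w'] fin
      by (auto simp: pull_op_def[of W] id_tensor_map_apply mem_Times_iff)
        (auto simp: pull_op_def intro!: sum.cong)
  qed
  finally show ?thesis .
qed

text \<open>The Choi operator is positive, hence Hermitian.\<close>

lemma CP_hermitian_preserving:
  fixes A :: "'a set"
  assumes N: "CP A B N" and fin: "finite A" "finite B" and "i \<in> A" "j \<in> A"
  shows "N (munit j i) l k = cnj (N (munit i j) k l)"
proof -
  \<comment> \<open>The unnormalised maximally entangled operator. Its quadratic form at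
    \<open>v\<close> is the squared modulus of the sum of the diagonal entries of \<open>v\<close>,
    and its image under \<open>N\<close> with reference \<open>A\<close> is the Choi
    operator.\<close>
  let ?\<Omega> = "\<lambda>p q. if p \<in> A \<times> A \<and> q \<in> A \<times> A \<and> fst p = snd p \<and> fst q = snd q then 1 else (0::complex)"
  have "positive (A \<times> A) ?\<Omega>"
    unfolding positive_def
  proof (intro conjI ballI)
    show "?\<Omega> \<in> opers (A \<times> A)" by (auto simp: opers_def)
    fix v :: "('a \<times> 'a) vect"
    let ?s = "\<Sum>q\<in>A \<times> A. if fst q = snd q then v q else 0"
    have "inner_on (A \<times> A) v (apply_op (A \<times> A) ?\<Omega> v) =
        (\<Sum>p\<in>A \<times> A. (if fst p = snd p then cnj (v p) else 0) * ?s)"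
      unfolding inner_on_def apply_op_def sum_distrib_left by (intro sum.cong refl) auto
    also have "\<dots> = cnj ?s * ?s"
      unfolding sum_distrib_right[symmetric] cnj_sum
      by (intro arg_cong2[where f = "(*)"] sum.cong refl) auto
    also have "\<dots> = of_real ((cmod ?s)\<^sup>2)"
      by (simp only: complex_norm_square mult.commute)
    finally show "inner_on (A \<times> A) v (apply_op (A \<times> A) ?\<Omega> v) \<in> \<real>\<^sub>\<ge>\<^sub>0" by simp
  qed
  then have "positive (A \<times> B) (id_tensor_map A A N ?\<Omega>)"
    using assms by (intro CP_positive) auto
  then have H: "hermitian (A \<times> B) (id_tensor_map A A N ?\<Omega>)"
    using fin by (intro positive_hermitian) auto
  have c: "id_tensor_map A A N ?\<Omega> (x, k) (y, l) = N (munit x y) k l" if "x \<in> A" "y \<in> A" for x y k l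
  proof -
    have "id_tensor_map A A N ?\<Omega> (x, k) (y, l) =
        (\<Sum>i\<in>A. \<Sum>j\<in>A. if j = y then if i = x then N (munit x y) k l else 0 else 0)"
      unfolding id_tensor_map_apply[OF fin(1) fin(1)] using that
      by (auto intro!: sum.cong)
    then show ?thesis using that fin by simp
  qed
  from H have "id_tensor_map A A N ?\<Omega> (j, l) (i, k) = cnj (id_tensor_map A A N ?\<Omega> (i, k) (j, l))"
    unfolding hermitian_def by blast
  then show ?thesis unfolding c[OF assms(4,5)] c[OF assms(5,4)] .
qed

text \<open>By linearity it suffices to test matrix units, the only arguments at which product maps
  and tensored supermaps have explicit values.\<close>

lemma TP_iff:
  assumes "finite A" "N \<in> lmaps A B"
  shows "TP A B N \<longleftrightarrow> (\<forall>i\<in>A. \<forall>j\<in>A. tr B (N (munit i j)) = (if i = j then 1 else 0))"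
proof
  assume N: "TP A B N"
  show "\<forall>i\<in>A. \<forall>j\<in>A. tr B (N (munit i j)) = (if i = j then 1 else 0)"
  proof (intro ballI)
    fix i j assume "i \<in> A" "j \<in> A"
    then have "munit i j \<in> opers A" by (auto simp: opers_def munit_def)
    then show "tr B (N (munit i j)) = (if i = j then 1 else 0)"
      using N \<open>i \<in> A\<close> by (simp add: TP_def tr_munit[OF assms(1)])
  qed
next
  assume N: "\<forall>i\<in>A. \<forall>j\<in>A. tr B (N (munit i j)) = (if i = j then 1 else 0)"
  have "tr B (N X) = tr A X" for X
  proof -
    have "tr B (N X) = (\<Sum>k\<in>B. \<Sum>i\<in>A. \<Sum>j\<in>A. X i j * N (munit i j) k k)"
      unfolding tr_def lmaps_expand[OF assms(2,1), of X] by (simp add: sum.cartesian_product')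
    also have "\<dots> = (\<Sum>i\<in>A. \<Sum>k\<in>B. \<Sum>j\<in>A. X i j * N (munit i j) k k)"
      by (rule sum.swap)
    also have "\<dots> = (\<Sum>i\<in>A. \<Sum>j\<in>A. X i j * tr B (N (munit i j)))"
      unfolding tr_def sum_distrib_left by (rule sum.cong[OF refl], rule sum.swap)
    also have "\<dots> = (\<Sum>i\<in>A. \<Sum>j\<in>A. if j = i then X i i else 0)"
      using N by (intro sum.cong refl) auto
    finally show ?thesis using assms(1) by (simp add: tr_def)
  qed
  then show "TP A B N" using assms by (simp add: TP_def)
qed

lemma tr_id_tensor_map:
  assumes N: "TP A B N" and fin: "finite E" "finite A"
  shows "tr (E \<times> B) (id_tensor_map E A N X) = tr (E \<times> A) X"
proof -
  have NL: "N \<in> lmaps A B" using N by (simp add: TP_def)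
  have "tr (E \<times> B) (id_tensor_map E A N X) = (\<Sum>e\<in>E. \<Sum>k\<in>B. \<Sum>i\<in>A. \<Sum>j\<in>A. X (e, i) (e, j) * N (munit i j) k k)"
    unfolding tr_def sum.cartesian_product' id_tensor_map_apply[OF fin] by (intro sum.cong refl) simp
  also have "\<dots> = (\<Sum>e\<in>E. \<Sum>i\<in>A. \<Sum>k\<in>B. \<Sum>j\<in>A. X (e, i) (e, j) * N (munit i j) k k)"
    by (rule sum.cong[OF refl], rule sum.swap)
  also have "\<dots> = (\<Sum>e\<in>E. \<Sum>i\<in>A. \<Sum>j\<in>A. X (e, i) (e, j) * tr B (N (munit i j)))"
    unfolding tr_def sum_distrib_left by (rule sum.cong[OF refl], rule sum.cong[OF refl], rule sum.swap)
  also have "\<dots> = (\<Sum>e\<in>E. \<Sum>i\<in>A. \<Sum>j\<in>A. if j = i then X (e, i) (e, i) else 0)"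
    using N[unfolded TP_iff[OF fin(2) NL]] by (intro sum.cong refl) auto
  finally show ?thesis using fin by (simp add: tr_def sum.cartesian_product')
qed


subsection \<open>Products of channels and of supermaps\<close>

text \<open>The tensor product of \<open>N\<close> and \<open>M\<close> in other labels:
  \<open>g\<close> and \<open>h\<close> distribute the input and output labels over the two factors,
  which allows the interleaved order of labels of the composite system.\<close>

definition product_map :: "'z set \<Rightarrow> ('z \<Rightarrow> 'a \<times> 'c) \<Rightarrow> 'w set \<Rightarrow> ('w \<Rightarrow> 'b \<times> 'd) \<Rightarrow>
    ('a, 'b) omap \<Rightarrow> ('c, 'd) omap \<Rightarrow> ('z, 'w) omap" where
  "product_map Z g W h N M = (\<lambda>X. pull_op W h (\<lambda>p q. \<Sum>x\<in>Z. \<Sum>y\<in>Z. X x y *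
     (N (munit (fst (g x)) (fst (g y))) (fst p) (fst q) * M (munit (snd (g x)) (snd (g y))) (snd p) (snd q))))"

lemma product_map_munit:
  assumes "finite Z" "x \<in> Z" "y \<in> Z" "p \<in> W" "q \<in> W"
  shows "product_map Z g W h N M (munit x y) p q =
    N (munit (fst (g x)) (fst (g y))) (fst (h p)) (fst (h q)) *
    M (munit (snd (g x)) (snd (g y))) (snd (h p)) (snd (h q))"
proof -
  let ?c = "\<lambda>u v. N (munit (fst (g u)) (fst (g v))) (fst (h p)) (fst (h q)) *
    M (munit (snd (g u)) (snd (g v))) (snd (h p)) (snd (h q))"
  have "product_map Z g W h N M (munit x y) p q = (\<Sum>u\<in>Z. \<Sum>v\<in>Z. munit x y u v * ?c u v)"
    using assms by (simp add: product_map_def pull_op_def)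
  also have "\<dots> = (\<Sum>u\<in>Z. \<Sum>v\<in>Z. if v = y then if u = x then ?c x y else 0 else 0)"
    by (intro sum.cong refl) (auto simp: munit_apply[of x y])
  finally show ?thesis using assms by simp
qed

lemma product_map_lmaps: "product_map Z g W h N M \<in> lmaps Z W"
proof -
  have "product_map Z g W h N M (\<lambda>i j. c * X i j + Y i j) p q =
      c * product_map Z g W h N M X p q + product_map Z g W h N M Y p q" for c X Y p q
    by (simp add: product_map_def pull_op_def sum_distrib_left distrib_right sum.distrib mult.assoc)
  moreover have "product_map Z g W h N M X \<in> opers W" for X
    by (auto simp: product_map_def pull_op_def opers_def)
  moreover have "product_map Z g W h N M (compress Z X) = product_map Z g W h N M X" for X
    by (auto simp: product_map_def compress_def intro!: arg_cong[of _ _ "pull_op W h"] ext sum.cong)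
  ultimately show ?thesis by (simp add: lmaps_def fun_eq_iff)
qed

lemma product_map_TP:
  assumes fin: "finite P" "finite Q" and g: "bij_betw g Z (P \<times> Q)" and h: "bij_betw h W (R \<times> S)"
    and N: "TP P R N" and M: "TP Q S M"
  shows "TP Z W (product_map Z g W h N M)"
proof -
  have finZ: "finite Z" using g fin by (simp add: bij_betw_finite)
  have gZ: "fst (g z) \<in> P" "snd (g z) \<in> Q" if "z \<in> Z" for z
    using bij_betwE[OF g] that by (auto simp: mem_Times_iff)
  have inj: "z = w" if "z \<in> Z" "w \<in> Z" "fst (g z) = fst (g w)" "snd (g z) = snd (g w)" for z w
    using g that by (auto simp: bij_betw_def inj_on_def prod_eq_iff)
  have L: "N \<in> lmaps P R" "M \<in> lmaps Q S" using N M by (auto simp: TP_def)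
  have "tr W (product_map Z g W h N M (munit x y)) = (if x = y then 1 else 0)"
    if "x \<in> Z" "y \<in> Z" for x y
  proof -
    have "tr W (product_map Z g W h N M (munit x y)) =
        (\<Sum>w\<in>W. N (munit (fst (g x)) (fst (g y))) (fst (h w)) (fst (h w)) *
          M (munit (snd (g x)) (snd (g y))) (snd (h w)) (snd (h w)))"
      unfolding tr_def using finZ that by (intro sum.cong refl) (simp add: product_map_munit)
    also have "\<dots> = tr R (N (munit (fst (g x)) (fst (g y)))) * tr S (M (munit (snd (g x)) (snd (g y))))"
      unfolding tr_def sum_product
      by (rule sum_bij_pairs[OF h, of "\<lambda>r s. N (munit (fst (g x)) (fst (g y))) r r * M (munit (snd (g x)) (snd (g y))) s s"])
    finally show ?thesis
      using N M gZ[OF that(1)] gZ[OF that(2)] inj[OF that] TP_iff[OF fin(1) L(1)] TP_iff[OF fin(2) L(2)]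
      by auto
  qed
  then show ?thesis using TP_iff[OF finZ product_map_lmaps] by blast
qed

text \<open>
  The product map is applied one factor at a time, with all other labels moved into the reference
  system.
\<close>

lemma product_map_CP:
  assumes fin: "finite P" "finite Q" "finite R" "finite S" "finite W" and ne: "Q \<noteq> {}" "R \<noteq> {}"
    and g: "bij_betw g Z (P \<times> Q)" and h: "h ` W \<subseteq> R \<times> S"
    and N: "CP P R N" and M: "CP Q S M"
  shows "CP Z W (product_map Z g W h N M)"
  unfolding CP_def
proof (intro conjI allI impI product_map_lmaps)
  fix n :: nat and X assume "n > 0" and X: "positive ({..<n} \<times> Z) X"
  let ?K = "{..<n}"
  have finZ: "finite Z" using g fin by (simp add: bij_betw_finite)
  define f where "f = inv_into Z g"
  have f: "f pq \<in> Z" if "pq \<in> P \<times> Q" for pq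
    using g that unfolding f_def by (metis bij_betw_def inv_into_into)
  have fg: "f (g z) = z" if "z \<in> Z" for z
    using g that unfolding f_def by (simp add: bij_betw_inv_into_left)
  \<comment> \<open>For \<open>N\<close> the reference consists of the outer label and the label in
    \<open>Q\<close>. For \<open>M\<close> it is the outer label with the output in \<open>R\<close>
    of the first step: \<open>?g2\<close> exchanges the labels in \<open>Q\<close> and
    \<open>R\<close>, and \<open>?h2\<close> reads off the final outputs.\<close>
  let ?g1 = "\<lambda>p. (fst (fst p), f (snd p, snd (fst p)))"
  let ?g2 = "\<lambda>p. ((fst (fst p), snd p), snd (fst p))"
  let ?h2 = "\<lambda>w. ((fst w, fst (h (snd w))), snd (h (snd w)))"
  define X1 where "X1 = (\<lambda>w w'. if w \<in> (?K \<times> Q) \<times> R \<and> w' \<in> (?K \<times> Q) \<times> R then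
    \<Sum>i\<in>P. \<Sum>j\<in>P. X (?g1 (fst (id w), i)) (?g1 (fst (id w'), j)) *
      N (munit i j) (snd (id w)) (snd (id w')) else 0)"
  have X1: "positive ((?K \<times> Q) \<times> R) X1"
    unfolding X1_def using fin finZ f ne \<open>n > 0\<close>
    by (intro CP_positive_relabel[OF N _ _ _ _ _ _ X]) auto
  have "positive (?K \<times> W) (\<lambda>w w'. if w \<in> ?K \<times> W \<and> w' \<in> ?K \<times> W then
    \<Sum>i\<in>Q. \<Sum>j\<in>Q. X1 (?g2 (fst (?h2 w), i)) (?g2 (fst (?h2 w'), j)) *
      M (munit i j) (snd (?h2 w)) (snd (?h2 w')) else 0)" (is "positive _ ?L")
    using fin finZ ne \<open>n > 0\<close> h
    by (intro CP_positive_relabel[OF M, where E = "?K \<times> R", OF _ _ _ _ _ _ X1]) (auto simp: mem_Times_iff)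
  also have "?L = id_tensor_map ?K Z (product_map Z g W h N M) X" (is "_ = ?R")
  proof (intro ext)
    fix w w'
    show "?L w w' = ?R w w'"
    proof (cases "w \<in> ?K \<times> W \<and> w' \<in> ?K \<times> W")
      case False
      then have "?R w w' = 0"
        using fin finZ by (auto simp: id_tensor_map_apply product_map_def pull_op_def mem_Times_iff)
      then show ?thesis using False by (simp only: if_False)
    next
      case True
      obtain k a k' b where w: "w = (k, a)" "w' = (k', b)" by (cases w, cases w')
      have in': "k \<in> ?K" "k' \<in> ?K" "a \<in> W" "b \<in> W" using True w by auto
      have hR: "fst (h a) \<in> R" "fst (h b) \<in> R" using h in' by (auto simp: image_subset_iff mem_Times_iff)
      let ?F = "\<lambda>p q p' q'. X (k, f (p, q)) (k', f (p', q')) *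
        (N (munit p p') (fst (h a)) (fst (h b)) * M (munit q q') (snd (h a)) (snd (h b)))"
      have "?R w w' = (\<Sum>z\<in>Z. \<Sum>z'\<in>Z. ?F (fst (g z)) (snd (g z)) (fst (g z')) (snd (g z')))"
        unfolding id_tensor_map_apply[OF finite_lessThan finZ] w fst_conv snd_conv
        using in' finZ by (auto intro!: sum.cong simp: product_map_munit fg)
      also have "\<dots> = (\<Sum>p\<in>P. \<Sum>q\<in>Q. \<Sum>z'\<in>Z. ?F p q (fst (g z')) (snd (g z')))"
        by (rule sum_bij_pairs[OF g, of "\<lambda>p q. \<Sum>z'\<in>Z. ?F p q (fst (g z')) (snd (g z'))"])
      also have "\<dots> = (\<Sum>p\<in>P. \<Sum>q\<in>Q. \<Sum>p'\<in>P. \<Sum>q'\<in>Q. ?F p q p' q')"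
        by (intro sum.cong refl) (rule sum_bij_pairs[OF g])
      also have "\<dots> = (\<Sum>q\<in>Q. \<Sum>p\<in>P. \<Sum>q'\<in>Q. \<Sum>p'\<in>P. ?F p q p' q')"
        by (subst sum.swap, rule sum.cong[OF refl], rule sum.cong[OF refl], rule sum.swap)
      also have "\<dots> = (\<Sum>q\<in>Q. \<Sum>q'\<in>Q. \<Sum>p\<in>P. \<Sum>p'\<in>P. ?F p q p' q')"
        by (rule sum.cong[OF refl], rule sum.swap)
      also have "\<dots> = ?L w w'"
        using in' hR unfolding w X1_def
        by (auto intro!: sum.cong simp: sum_distrib_right mult.assoc)
      finally show ?thesis ..
    qed
  qed
  finally show "positive (?K \<times> W) (id_tensor_map ?K Z (product_map Z g W h N M) X)" .
qed

section \<open>Supermaps on matrix units and regrouped labels\<close>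

lemma tensor_supermap_opers:
  assumes "\<And>i j k l Y. i \<in> A \<Longrightarrow> j \<in> A \<Longrightarrow> k \<in> B \<Longrightarrow> l \<in> B \<Longrightarrow> \<Theta> (map_unit i j k l) Y \<in> opers D"
    and "\<And>i j k l Y. i \<in> A' \<Longrightarrow> j \<in> A' \<Longrightarrow> k \<in> B' \<Longrightarrow> l \<in> B' \<Longrightarrow> \<Gamma> (map_unit i j k l) Y \<in> opers D'"
  shows "tensor_supermap A B C A' B' C' \<Theta> \<Gamma> N Y \<in> opers (D \<times> D')"
proof -
  have "tensor_supermap A B C A' B' C' \<Theta> \<Gamma> N Y p q = 0" if "p \<notin> D \<times> D' \<or> q \<notin> D \<times> D'" for p q
    unfolding tensor_supermap_def case_prod_unfold
  proof (intro sum.neutral ballI)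
    fix i j k l assume *: "i \<in> A \<times> A'" "j \<in> A \<times> A'" "k \<in> B \<times> B'" "l \<in> B \<times> B'"
    have "tensor_map C C' (\<Theta> (map_unit (fst i) (fst j) (fst k) (fst l)))
        (\<Gamma> (map_unit (snd i) (snd j) (snd k) (snd l))) Y \<in> opers (D \<times> D')"
      using * by (intro tensor_map_opers assms) auto
    from opersD[OF this that] show "N (munit (fst i, snd i) (fst j, snd j)) (fst k, snd k) (fst l, snd l) *
        tensor_map C C' (\<Theta> (map_unit (fst i) (fst j) (fst k) (fst l)))
        (\<Gamma> (map_unit (snd i) (snd j) (snd k) (snd l))) Y p q = 0"
      by simp
  qed
  then show ?thesis by (auto simp: opers_def)
qed

lemma tensor_supermap_map_unit:
  assumes "finite A" "finite A'" "finite B" "finite B'"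
    and "i \<in> A \<times> A'" "j \<in> A \<times> A'" "k \<in> B \<times> B'" "l \<in> B \<times> B'"
  shows "tensor_supermap A B C A' B' C' \<Theta> \<Gamma> (map_unit i j k l) =
    tensor_map C C' (\<Theta> (map_unit (fst i) (fst j) (fst k) (fst l)))
      (\<Gamma> (map_unit (snd i) (snd j) (snd k) (snd l)))" (is "_ = ?T")
proof (intro ext)
  fix Y p q
  have "tensor_supermap A B C A' B' C' \<Theta> \<Gamma> (map_unit i j k l) Y p q =
    (\<Sum>x\<in>A \<times> A'. \<Sum>y\<in>A \<times> A'. \<Sum>z\<in>B \<times> B'. \<Sum>w\<in>B \<times> B'.
       if w = l then if z = k then if y = j then if x = i then ?T Y p q else 0 else 0 else 0 else 0)"
    unfolding tensor_supermap_def case_prod_unfold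
    by (intro sum.cong refl) (auto simp: map_unit_def munit_def)
  then show "tensor_supermap A B C A' B' C' \<Theta> \<Gamma> (map_unit i j k l) Y p q = ?T Y p q"
    using assms by simp
qed

text \<open>Moves a Kronecker delta outward past the sums that it does not involve, so that nested
  deltas collapse one by one.\<close>

lemma sum_if_const: "(\<Sum>x\<in>S. if c then F x else 0) = (if c then \<Sum>x\<in>S. F x else 0)"
  by simp

text \<open>The identity supermap fixes all four reference labels, two at the input and two at the
  output, so that only the expansion of the blocks of \<open>N\<close> in \<open>map_unit\<close>
  remains.\<close>

lemma id_tensor_supermap_munit:
  assumes fin: "finite E" "finite C" and "x \<in> E \<times> C" "y \<in> E \<times> C" "fst p \<in> E" "fst q \<in> E"
  shows "id_tensor_supermap E E A B C \<Theta> N (munit x y) p q =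
    (\<Sum>i\<in>A. \<Sum>j\<in>A. \<Sum>k\<in>B. \<Sum>l\<in>B. N (munit (fst x, i) (fst y, j)) (fst p, k) (fst q, l) *
       \<Theta> (map_unit i j k l) (munit (snd x) (snd y)) (snd p) (snd q))"
proof -
  have xy: "fst x \<in> E" "fst y \<in> E" using assms by auto
  have "id_tensor_supermap E E A B C \<Theta> N (munit x y) p q =
    (\<Sum>r\<in>E. \<Sum>i\<in>A. \<Sum>s\<in>E. \<Sum>j\<in>A. \<Sum>u\<in>E. \<Sum>k\<in>B. \<Sum>v\<in>E. \<Sum>l\<in>B.
      if v = fst q then if u = fst p then if s = fst y then if r = fst x then
       N (munit (fst x, i) (fst y, j)) (fst p, k) (fst q, l) *
       \<Theta> (map_unit i j k l) (munit (snd x) (snd y)) (snd p) (snd q) else 0 else 0 else 0 else 0)"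
    unfolding tensor_supermap_def case_prod_unfold tensor_map_munit[OF assms(1-4)]
      sum.cartesian_product' fst_conv snd_conv
    by (intro sum.cong refl) (auto simp: map_unit_def munit_def)
  then show ?thesis
    by (simp only: sum_if_const sum.delta[OF fin(1)] xy assms(5,6) if_True)
qed

text \<open>Splits a merged reference label by \<open>\<phi>\<close> and a system label by
  \<open>\<sigma>\<close>, and groups each reference with its own system. Being of the same type
  pattern as \<open>\<sigma>\<close>, it can be nested: once for the reference of the channel, once
  for that of the state.\<close>

definition shuffle :: "('e \<Rightarrow> 'r \<times> 's) \<Rightarrow> ('z \<Rightarrow> 'a \<times> 'b) \<Rightarrow> 'e \<times> 'z \<Rightarrow> ('r \<times> 'a) \<times> ('s \<times> 'b)" where
  "shuffle \<phi> \<sigma> = (\<lambda>(e, z). ((fst (\<phi> e), fst (\<sigma> z)), (snd (\<phi> e), snd (\<sigma> z))))"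

lemma shuffle_simps:
  "fst (shuffle \<phi> \<sigma> p) = (fst (\<phi> (fst p)), fst (\<sigma> (snd p)))"
  "snd (shuffle \<phi> \<sigma> p) = (snd (\<phi> (fst p)), snd (\<sigma> (snd p)))"
  by (simp_all add: shuffle_def case_prod_unfold)

lemma bij_betw_shuffle:
  assumes "bij_betw \<phi> E (R \<times> S)" "bij_betw \<sigma> Z (A \<times> B)"
  shows "bij_betw (shuffle \<phi> \<sigma>) (E \<times> Z) ((R \<times> A) \<times> (S \<times> B))"
proof -
  have "bij_betw (\<lambda>((r, s), (a, b)). ((r, a), (s, b))) ((R \<times> S) \<times> (A \<times> B)) ((R \<times> A) \<times> (S \<times> B))"
    by (rule bij_betw_byWitness[where f' = "\<lambda>((r, a), (s, b)). ((r, s), (a, b))"]) auto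
  from bij_betw_trans[OF bij_betw_map_prod[OF assms] this]
  show ?thesis
    by (rule bij_betw_cong[THEN iffD1, rotated]) (auto simp: shuffle_def case_prod_unfold)
qed

lemma sum4_pairs:
  fixes F G :: "_ \<Rightarrow> _ \<Rightarrow> _ \<Rightarrow> _ \<Rightarrow> complex"
  assumes "finite A" "finite A'" "finite B" "finite B'"
  shows "(\<Sum>i\<in>A \<times> A'. \<Sum>j\<in>A \<times> A'. \<Sum>k\<in>B \<times> B'. \<Sum>l\<in>B \<times> B'.
      F (fst i) (fst j) (fst k) (fst l) * G (snd i) (snd j) (snd k) (snd l)) =
    (\<Sum>i\<in>A. \<Sum>j\<in>A. \<Sum>k\<in>B. \<Sum>l\<in>B. F i j k l) * (\<Sum>i\<in>A'. \<Sum>j\<in>A'. \<Sum>k\<in>B'. \<Sum>l\<in>B'. G i j k l)"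
proof -
  note p = sum_pairs[unfolded case_prod_unfold sum.cartesian_product' fst_conv snd_conv]
  have "(\<Sum>i\<in>A \<times> A'. \<Sum>j\<in>A \<times> A'. \<Sum>k\<in>B \<times> B'. \<Sum>l\<in>B \<times> B'.
      F (fst i) (fst j) (fst k) (fst l) * G (snd i) (snd j) (snd k) (snd l)) =
    (\<Sum>i\<in>A \<times> A'. \<Sum>j\<in>A \<times> A'. (\<Sum>k\<in>B. \<Sum>l\<in>B. F (fst i) (fst j) k l) *
      (\<Sum>k\<in>B'. \<Sum>l\<in>B'. G (snd i) (snd j) k l))"
    unfolding sum.cartesian_product' fst_conv snd_conv
    by (intro sum.cong refl p assms)
  also have "\<dots> = (\<Sum>i\<in>A. \<Sum>j\<in>A. \<Sum>k\<in>B. \<Sum>l\<in>B. F i j k l) * (\<Sum>i\<in>A'. \<Sum>j\<in>A'. \<Sum>k\<in>B'. \<Sum>l\<in>B'. G i j k l)"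
    unfolding sum.cartesian_product' fst_conv snd_conv by (rule p[OF assms(1,2)])
  finally show ?thesis .
qed

text \<open>Up to regrouping, the tensored supermap sends a product of channels to the product of
  the images. In coordinates, the fourfold sum over pairs of labels separates into one sum for each
  factor.\<close>

lemma id_tensor_supermap_product:
  assumes fin: "finite E" "finite E1" "finite E2" "finite A" "finite A'" "finite B" "finite B'" "finite C" "finite C'"
    and \<phi>: "bij_betw \<phi> E (E1 \<times> E2)"
    and x: "x \<in> E \<times> (C \<times> C')" and y: "y \<in> E \<times> (C \<times> C')" and p: "fst p \<in> E" and q: "fst q \<in> E"
  shows "id_tensor_supermap E E (A \<times> A') (B \<times> B') (C \<times> C') (tensor_supermap A B C A' B' C' \<Theta> \<Gamma>)
      (product_map (E \<times> (A \<times> A')) (shuffle \<phi> id) (E \<times> (B \<times> B')) (shuffle \<phi> id) N M) (munit x y) p q =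
    id_tensor_supermap E1 E1 A B C \<Theta> N (munit (fst (shuffle \<phi> id x)) (fst (shuffle \<phi> id y)))
      (fst (shuffle \<phi> id p)) (fst (shuffle \<phi> id q)) *
    id_tensor_supermap E2 E2 A' B' C' \<Gamma> M (munit (snd (shuffle \<phi> id x)) (snd (shuffle \<phi> id y)))
      (snd (shuffle \<phi> id p)) (snd (shuffle \<phi> id q))"
    (is "?L = ?R1 * ?R2")
proof -
  have \<phi>E: "fst (\<phi> e) \<in> E1" "snd (\<phi> e) \<in> E2" if "e \<in> E" for e
    using bij_betwE[OF \<phi>] that by (auto simp: mem_Times_iff)
  have xy: "fst x \<in> E" "fst y \<in> E" "snd x \<in> C \<times> C'" "snd y \<in> C \<times> C'" using x y by auto
  note \<phi>s = \<phi>E[OF xy(1)] \<phi>E[OF xy(2)] \<phi>E[OF p] \<phi>E[OF q]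
  have fin': "finite (E \<times> (A \<times> A'))" "finite (C \<times> C')" using fin by auto
  have "?L = (\<Sum>i\<in>A \<times> A'. \<Sum>j\<in>A \<times> A'. \<Sum>k\<in>B \<times> B'. \<Sum>l\<in>B \<times> B'.
      (N (munit (fst (\<phi> (fst x)), fst i) (fst (\<phi> (fst y)), fst j)) (fst (\<phi> (fst p)), fst k) (fst (\<phi> (fst q)), fst l) *
       \<Theta> (map_unit (fst i) (fst j) (fst k) (fst l)) (munit (fst (snd x)) (fst (snd y))) (fst (snd p)) (fst (snd q))) *
      (M (munit (snd (\<phi> (fst x)), snd i) (snd (\<phi> (fst y)), snd j)) (snd (\<phi> (fst p)), snd k) (snd (\<phi> (fst q)), snd l) *
       \<Gamma> (map_unit (snd i) (snd j) (snd k) (snd l)) (munit (snd (snd x)) (snd (snd y))) (snd (snd p)) (snd (snd q))))"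
    unfolding id_tensor_supermap_munit[OF fin(1) fin'(2) x y p q]
  proof (intro sum.cong refl)
    fix i j k l assume *: "i \<in> A \<times> A'" "j \<in> A \<times> A'" "k \<in> B \<times> B'" "l \<in> B \<times> B'"
    have 1: "(fst x, i) \<in> E \<times> (A \<times> A')" "(fst y, j) \<in> E \<times> (A \<times> A')"
       "(fst p, k) \<in> E \<times> (B \<times> B')" "(fst q, l) \<in> E \<times> (B \<times> B')" using * xy p q by auto
    show "product_map (E \<times> (A \<times> A')) (shuffle \<phi> id) (E \<times> (B \<times> B')) (shuffle \<phi> id) N M
        (munit (fst x, i) (fst y, j)) (fst p, k) (fst q, l) *
        tensor_supermap A B C A' B' C' \<Theta> \<Gamma> (map_unit i j k l) (munit (snd x) (snd y)) (snd p) (snd q) =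
      (N (munit (fst (\<phi> (fst x)), fst i) (fst (\<phi> (fst y)), fst j)) (fst (\<phi> (fst p)), fst k) (fst (\<phi> (fst q)), fst l) *
       \<Theta> (map_unit (fst i) (fst j) (fst k) (fst l)) (munit (fst (snd x)) (fst (snd y))) (fst (snd p)) (fst (snd q))) *
      (M (munit (snd (\<phi> (fst x)), snd i) (snd (\<phi> (fst y)), snd j)) (snd (\<phi> (fst p)), snd k) (snd (\<phi> (fst q)), snd l) *
       \<Gamma> (map_unit (snd i) (snd j) (snd k) (snd l)) (munit (snd (snd x)) (snd (snd y))) (snd (snd p)) (snd (snd q)))"
      unfolding product_map_munit[OF fin'(1) 1] tensor_supermap_map_unit[OF fin(4-7) *]
        tensor_map_munit[OF fin(8,9) xy(3,4)] shuffle_simps id_apply fst_conv snd_conv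
      by (simp only: mult_ac)
  qed
  also have "\<dots> = ?R1 * ?R2"
  proof -
    let ?F = "\<lambda>i j k l.
      N (munit (fst (\<phi> (fst x)), i) (fst (\<phi> (fst y)), j)) (fst (\<phi> (fst p)), k) (fst (\<phi> (fst q)), l) *
      \<Theta> (map_unit i j k l) (munit (fst (snd x)) (fst (snd y))) (fst (snd p)) (fst (snd q))"
    let ?G = "\<lambda>i j k l.
      M (munit (snd (\<phi> (fst x)), i) (snd (\<phi> (fst y)), j)) (snd (\<phi> (fst p)), k) (snd (\<phi> (fst q)), l) *
      \<Gamma> (map_unit i j k l) (munit (snd (snd x)) (snd (snd y))) (snd (snd p)) (snd (snd q))"
    have R1: "?R1 = (\<Sum>i\<in>A. \<Sum>j\<in>A. \<Sum>k\<in>B. \<Sum>l\<in>B. ?F i j k l)"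
      using fin \<phi>s xy by (subst id_tensor_supermap_munit) (auto simp: shuffle_simps mem_Times_iff)
    have R2: "?R2 = (\<Sum>i\<in>A'. \<Sum>j\<in>A'. \<Sum>k\<in>B'. \<Sum>l\<in>B'. ?G i j k l)"
      using fin \<phi>s xy by (subst id_tensor_supermap_munit) (auto simp: shuffle_simps mem_Times_iff)
    show ?thesis unfolding R1 R2 by (rule sum4_pairs[OF fin(4-7), of ?F ?G])
  qed
  finally show ?thesis .
qed

text \<open>The counterpart one level lower, for states instead of channels: if \<open>T\<close>
  factorises on matrix units along \<open>\<sigma>\<close> and \<open>\<tau>\<close>, it factorises
  on product operators, with the references merged by \<open>\<psi>\<close>.\<close>

lemma id_tensor_map_product:
  assumes fin: "finite K" "finite K1" "finite K2" "finite P" "finite Q"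
    and \<psi>: "bij_betw \<psi> K (K1 \<times> K2)" and \<sigma>: "bij_betw \<sigma> Z (P \<times> Q)"
    and T: "\<And>x y p q. x \<in> Z \<Longrightarrow> y \<in> Z \<Longrightarrow> p \<in> W \<Longrightarrow> q \<in> W \<Longrightarrow> T (munit x y) p q =
      N (munit (fst (\<sigma> x)) (fst (\<sigma> y))) (fst (\<tau> p)) (fst (\<tau> q)) *
      M (munit (snd (\<sigma> x)) (snd (\<sigma> y))) (snd (\<tau> p)) (snd (\<tau> q))"
    and T0: "\<And>x y. T (munit x y) \<in> opers W"
  shows "id_tensor_map K Z T (pull_op (K \<times> Z) (shuffle \<psi> \<sigma>) (tensor_op X X')) =
    pull_op (K \<times> W) (shuffle \<psi> \<tau>) (tensor_op (id_tensor_map K1 P N X) (id_tensor_map K2 Q M X'))"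
    (is "?L = ?R")
proof (intro ext)
  fix p q
  have finZ: "finite Z" using \<sigma> fin by (simp add: bij_betw_finite)
  have \<psi>K: "fst (\<psi> e) \<in> K1" "snd (\<psi> e) \<in> K2" if "e \<in> K" for e
    using bij_betwE[OF \<psi>] that by (auto simp: mem_Times_iff)
  show "?L p q = ?R p q"
  proof (cases "p \<in> K \<times> W \<and> q \<in> K \<times> W")
    case False
    then show ?thesis
      using opersD[OF T0] unfolding id_tensor_map_apply[OF fin(1) finZ]
      by (auto simp: pull_op_def mem_Times_iff intro!: sum.neutral)
  next
    case True
    then have pq: "fst p \<in> K" "fst q \<in> K" "snd p \<in> W" "snd q \<in> W" by auto
    let ?F = "\<lambda>i i' j j'.
      (X (fst (\<psi> (fst p)), i) (fst (\<psi> (fst q)), j) * N (munit i j) (fst (\<tau> (snd p))) (fst (\<tau> (snd q)))) *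
      (X' (snd (\<psi> (fst p)), i') (snd (\<psi> (fst q)), j') * M (munit i' j') (snd (\<tau> (snd p))) (snd (\<tau> (snd q))))"
    have "?L p q = (\<Sum>x\<in>Z. \<Sum>y\<in>Z. ?F (fst (\<sigma> x)) (snd (\<sigma> x)) (fst (\<sigma> y)) (snd (\<sigma> y)))"
      unfolding id_tensor_map_apply[OF fin(1) finZ]
      using pq by (auto simp: pull_op_def tensor_op_def case_prod_unfold shuffle_simps T mult_ac intro!: sum.cong)
    also have "\<dots> = (\<Sum>i\<in>P. \<Sum>i'\<in>Q. \<Sum>y\<in>Z. ?F i i' (fst (\<sigma> y)) (snd (\<sigma> y)))"
      by (rule sum_bij_pairs[OF \<sigma>, of "\<lambda>i i'. \<Sum>y\<in>Z. ?F i i' (fst (\<sigma> y)) (snd (\<sigma> y))"])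
    also have "\<dots> = (\<Sum>i\<in>P. \<Sum>i'\<in>Q. \<Sum>j\<in>P. \<Sum>j'\<in>Q. ?F i i' j j')"
      by (intro sum.cong refl) (rule sum_bij_pairs[OF \<sigma>])
    also have "\<dots> = ?R p q"
      using pq \<psi>K[OF pq(1)] \<psi>K[OF pq(2)] True fin
      by (simp add: pull_op_def tensor_op_def case_prod_unfold shuffle_simps id_tensor_map_apply sum_product)
    finally show ?thesis .
  qed
qed


subsection \<open>Superadditivity of the divergence\<close>

text \<open>
  A fixed pair of reference labels turns a map on the composite system into one between \<open>A\<close> and
  \<open>B\<close> which, after tracing out the reference output, preserves the trace or annihilates it; the
  second case follows from the first by linearity.
\<close>

lemma superchannel_id_channel:
  assumes S: "superchannel A B C D \<Theta>" and "hilbert_space A" "hilbert_space B" "hilbert_space C" "hilbert_space D"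
    and n: "n > 0" and N: "N \<in> channels ({..<n::nat} \<times> A) ({..<n} \<times> B)"
  shows "id_tensor_supermap {..<n} {..<n} A B C \<Theta> N \<in> channels ({..<n} \<times> C) ({..<n} \<times> D)"
proof -
  let ?E = "{..<n}" and ?M = "id_tensor_supermap {..<n} {..<n} A B C \<Theta> N"
  have fin: "finite A" "finite B" "finite C" "finite D" using assms by (auto simp: hilbert_space_def)
  have \<Theta>: "\<Theta> \<in> supermaps A B C D" and TPP: "TP_preserving A B C D \<Theta>"
    using S by (auto simp: superchannel_def)
  have CP: "CP (?E \<times> C) (?E \<times> D) ?M"
    using S N n unfolding superchannel_def completely_CP_preserving_def CP_preserving_def channels_def
    by blast
  then have Mlm: "?M \<in> lmaps (?E \<times> C) (?E \<times> D)" by (simp add: CP_def)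
  have NL: "N \<in> lmaps (?E \<times> A) (?E \<times> B)" and NT: "TP (?E \<times> A) (?E \<times> B) N"
    using N by (auto simp: channels_def TP_def)
  \<comment> \<open>\<open>R r s\<close> feeds the matrix unit of \<open>r\<close> and
    \<open>s\<close> into the reference input of \<open>N\<close> and traces out the reference
    output; \<open>c\<close> are its coefficients.\<close>
  define c where "c = (\<lambda>r s i j k l. \<Sum>e\<in>?E. N (munit (r, i) (s, j)) (e, k) (e, l))"
  define R where "R = (\<lambda>r s X k l. if k \<in> B \<and> l \<in> B then \<Sum>i\<in>A. \<Sum>j\<in>A. X i j * c r s i j k l else 0)"
  have RL: "R r s \<in> lmaps A B" for r s
    unfolding lmaps_def
  proof (intro CollectI conjI allI)
    fix d X Y
    show "R r s (\<lambda>i j. d * X i j + Y i j) = (\<lambda>k l. d * R r s X k l + R r s Y k l)"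
      by (auto simp: R_def fun_eq_iff sum_distrib_left distrib_right sum.distrib mult.assoc)
    show "R r s X \<in> opers B" by (auto simp: R_def opers_def)
    show "R r s (compress A X) = R r s X"
      by (auto simp: R_def compress_def fun_eq_iff intro!: sum.cong)
  qed
  have Rm: "R r s (munit i j) k l = c r s i j k l" if "i \<in> A" "j \<in> A" "k \<in> B" "l \<in> B" for r s i j k l
  proof -
    have "R r s (munit i j) k l = (\<Sum>x\<in>A. \<Sum>y\<in>A. munit i j x y * c r s x y k l)"
      using that by (simp add: R_def)
    also have "\<dots> = (\<Sum>x\<in>A. \<Sum>y\<in>A. if y = j then if x = i then c r s i j k l else 0 else 0)"
      by (intro sum.cong refl) (auto simp: munit_apply[of i j])
    finally show ?thesis using that fin by simp
  qed
  have trR: "tr B (R r s (munit i j)) = (if r = s \<and> i = j then 1 else 0)"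
    if "r \<in> ?E" "s \<in> ?E" "i \<in> A" "j \<in> A" for r s i j
  proof -
    have "tr B (R r s (munit i j)) = (\<Sum>k\<in>B. c r s i j k k)"
      unfolding tr_def using that by (intro sum.cong refl) (simp add: Rm)
    also have "\<dots> = tr (?E \<times> B) (N (munit (r, i) (s, j)))"
      unfolding c_def tr_def sum.cartesian_product' by (rule sum.swap)
    also have "\<dots> = (if (r, i) = (s, j) then 1 else 0)"
      using that fin NT[unfolded TP_iff[OF finite_cartesian_product[OF finite_lessThan fin(1)] NL]] by blast
    finally show ?thesis by simp
  qed
  have diag: "TP C D (\<Theta> (R r r))" if "r \<in> ?E" for r
    using TPP that trR unfolding TP_preserving_def
    by (auto simp: TP_iff[OF fin(1) RL])
  have tr\<Theta>: "tr D (\<Theta> (R r s) (munit x y)) = (if r = s \<and> x = y then 1 else 0)"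
    if "r \<in> ?E" "s \<in> ?E" "x \<in> C" "y \<in> C" for r s x y
  proof -
    have L: "\<Theta> (R r s) \<in> lmaps C D" for r s using \<Theta> RL by (auto simp: supermaps_def)
    have d: "tr D (\<Theta> (R r r) (munit x y)) = (if x = y then 1 else 0)"
      using diag[OF that(1)] that unfolding TP_iff[OF fin(3) L] by blast
    show ?thesis
    proof (cases "r = s")
      case False
      \<comment> \<open>Adding an annihilator of the trace to \<open>R r r\<close> leaves a
        trace-preserving map. The factor \<open>1\<close> matches the shape in which supermaps are
        linear.\<close>
      let ?S = "\<lambda>X k l. 1 * R r s X k l + R r r X k l"
      have SL: "?S \<in> lmaps A B"
        using RL[of r s] RL[of r r] unfolding lmaps_def opers_def by (simp add: algebra_simps fun_eq_iff)
      have "tr B (?S (munit i j)) = (if i = j then 1 else 0)" if "i \<in> A" "j \<in> A" for i j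
        using trR[OF \<open>r \<in> ?E\<close> \<open>s \<in> ?E\<close> that] trR[OF \<open>r \<in> ?E\<close> \<open>r \<in> ?E\<close> that] False
        by (simp add: tr_def sum.distrib)
      then have "TP A B ?S" unfolding TP_iff[OF fin(1) SL] by blast
      then have T: "TP C D (\<Theta> ?S)" using TPP by (simp add: TP_preserving_def)
      have eq: "\<Theta> ?S = (\<lambda>Y k l. 1 * \<Theta> (R r s) Y k l + \<Theta> (R r r) Y k l)"
        using \<Theta> RL[of r s] RL[of r r] unfolding supermaps_def by blast
      have "tr D (\<Theta> ?S (munit x y)) = (if x = y then 1 else 0)"
        using T that TP_iff[OF fin(3), of "\<Theta> ?S" D] by (simp add: TP_def)
      moreover have "tr D (\<Theta> ?S (munit x y)) = tr D (\<Theta> (R r s) (munit x y)) + tr D (\<Theta> (R r r) (munit x y))"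
        unfolding eq by (simp add: tr_def sum.distrib)
      ultimately show ?thesis using d False by simp
    qed (use d in simp)
  qed
  have "tr (?E \<times> D) (?M (munit x y)) = (if x = y then 1 else 0)" if xy: "x \<in> ?E \<times> C" "y \<in> ?E \<times> C" for x y
  proof -
    let ?T = "\<lambda>a i j k l. \<Theta> (map_unit i j k l) (munit (snd x) (snd y)) a a"
    have "tr (?E \<times> D) (?M (munit x y)) =
        (\<Sum>e\<in>?E. \<Sum>a\<in>D. \<Sum>i\<in>A. \<Sum>j\<in>A. \<Sum>k\<in>B. \<Sum>l\<in>B. N (munit (fst x, i) (fst y, j)) (e, k) (e, l) * ?T a i j k l)"
      unfolding tr_def sum.cartesian_product'
    proof (intro sum.cong refl)
      fix e a assume "e \<in> ?E"
      then show "?M (munit x y) (e, a) (e, a) =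
          (\<Sum>i\<in>A. \<Sum>j\<in>A. \<Sum>k\<in>B. \<Sum>l\<in>B. N (munit (fst x, i) (fst y, j)) (e, k) (e, l) * ?T a i j k l)"
        using xy by (subst id_tensor_supermap_munit[OF finite_lessThan fin(3) xy]) auto
    qed
    also have "\<dots> = (\<Sum>a\<in>D. \<Sum>i\<in>A. \<Sum>j\<in>A. \<Sum>k\<in>B. \<Sum>l\<in>B. \<Sum>e\<in>?E. N (munit (fst x, i) (fst y, j)) (e, k) (e, l) * ?T a i j k l)"
      by (subst sum.swap, rule sum.cong[OF refl], rule sum_swap4)
    \<comment> \<open>The sum over \<open>e\<close> is the coefficient of \<open>R\<close> at
      \<open>map_unit i j k l\<close>, so linearity of \<open>\<Theta>\<close> reassembles its value
      at \<open>R\<close>.\<close>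
    also have "\<dots> = tr D (\<Theta> (R (fst x) (fst y)) (munit (snd x) (snd y)))"
      unfolding tr_def supermap_expand[OF \<Theta> RL fin(1,2)] sum.cartesian_product' case_prod_unfold fst_conv snd_conv
      by (intro sum.cong refl) (simp add: Rm c_def sum_distrib_right)
    also have "\<dots> = (if x = y then 1 else 0)"
      using xy by (subst tr\<Theta>) (auto simp: prod_eq_iff)
    finally show ?thesis .
  qed
  then have "TP (?E \<times> C) (?E \<times> D) ?M"
    using TP_iff[OF finite_cartesian_product[OF finite_lessThan fin(3)] Mlm] by blast
  then show ?thesis using CP by (simp add: channels_def)
qed

section \<open>Hermiticity of the second arguments\<close>

lemma depol_supermap_opers: "depol_supermap A B C D N Y \<in> opers D"
  by (auto simp: depol_supermap_def depol_map_def opers_def op_id_def)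

lemma id_tensor_supermap_opers:
  assumes "\<And>i j k l Y. i \<in> A \<Longrightarrow> j \<in> A \<Longrightarrow> k \<in> B \<Longrightarrow> l \<in> B \<Longrightarrow> \<Theta> (map_unit i j k l) Y \<in> opers D"
  shows "id_tensor_supermap E E A B C \<Theta> N Y \<in> opers (E \<times> D)"
  using assms by (intro tensor_supermap_opers) (auto simp: map_unit_def munit_def opers_def)

lemma hermitian_id_tensor_map:
  assumes fin: "finite K" "finite Z" and M0: "\<And>x y. M (munit x y) \<in> opers W"
    and M: "\<And>x y p q. x \<in> Z \<Longrightarrow> y \<in> Z \<Longrightarrow> p \<in> W \<Longrightarrow> q \<in> W \<Longrightarrow> M (munit y x) q p = cnj (M (munit x y) p q)"
    and \<rho>: "hermitian (K \<times> Z) \<rho>"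
  shows "hermitian (K \<times> W) (id_tensor_map K Z M \<rho>)"
proof -
  have z: "id_tensor_map K Z M \<rho> p q = 0" if "p \<notin> K \<times> W \<or> q \<notin> K \<times> W" for p q
    using that opersD[OF M0] unfolding id_tensor_map_apply[OF fin]
    by (auto simp: mem_Times_iff intro!: sum.neutral)
  have r: "cnj (\<rho> p q) = \<rho> q p" for p q using \<rho> unfolding hermitian_def by metis
  have "id_tensor_map K Z M \<rho> q p = cnj (id_tensor_map K Z M \<rho> p q)" for p q
  proof (cases "p \<in> K \<times> W \<and> q \<in> K \<times> W")
    case False
    then show ?thesis using z[of p q] z[of q p] by auto
  next
    case True
    then have pq: "fst p \<in> K" "fst q \<in> K" "snd p \<in> W" "snd q \<in> W" by auto
    have "cnj (id_tensor_map K Z M \<rho> p q) =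
        (\<Sum>i\<in>Z. \<Sum>j\<in>Z. \<rho> (fst q, j) (fst p, i) * M (munit j i) (snd q) (snd p))"
      unfolding id_tensor_map_apply[OF fin] using pq
      by (auto simp: r M[OF _ _ pq(3,4)] intro!: sum.cong)
    also have "\<dots> = id_tensor_map K Z M \<rho> q p"
      unfolding id_tensor_map_apply[OF fin] using pq by (subst sum.swap) simp
    finally show ?thesis ..
  qed
  moreover have "id_tensor_map K Z M \<rho> \<in> opers (K \<times> W)" using z unfolding opers_def by blast
  ultimately show ?thesis unfolding hermitian_def by blast
qed

text \<open>On \<open>map_unit\<close> and matrix units the depolarizing supermap is a product of
  Kronecker deltas, hence real and symmetric under exchange of row and column labels. Hermiticity is
  therefore inherited from \<open>N\<close>.\<close>

lemma id_depol_hermitian: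
  assumes fin: "finite E" "finite A" "finite B" "finite C" and N: "CP (E \<times> A) (E \<times> B) N"
    and x: "x \<in> E \<times> C" and y: "y \<in> E \<times> C" and p: "p \<in> E \<times> D" and q: "q \<in> E \<times> D"
  shows "id_tensor_supermap E E A B C (depol_supermap A B C D) N (munit y x) q p =
    cnj (id_tensor_supermap E E A B C (depol_supermap A B C D) N (munit x y) p q)"
proof -
  let ?\<Theta> = "depol_supermap A B C D"
  have pq: "fst p \<in> E" "fst q \<in> E" using p q by auto
  have fin': "finite (E \<times> A)" "finite (E \<times> B)" using fin by auto
  have d: "?\<Theta> (map_unit j i l k) (munit b a) t s = cnj (?\<Theta> (map_unit i j k l) (munit a b) s t)" for i j k l a b s t
    by (auto simp: depol_supermap_def depol_map_def op_id_def tr_choi_map_unit[OF fin(2,3)] tr_munit[OF fin(4)])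
  have "cnj (id_tensor_supermap E E A B C ?\<Theta> N (munit x y) p q) =
    (\<Sum>i\<in>A. \<Sum>j\<in>A. \<Sum>k\<in>B. \<Sum>l\<in>B. N (munit (fst y, j) (fst x, i)) (fst q, l) (fst p, k) *
       ?\<Theta> (map_unit j i l k) (munit (snd y) (snd x)) (snd q) (snd p))"
    unfolding id_tensor_supermap_munit[OF fin(1,4) x y pq] cnj_sum complex_cnj_mult
  proof (intro sum.cong refl)
    fix i j k l assume "i \<in> A" "j \<in> A"
    then have "(fst x, i) \<in> E \<times> A" "(fst y, j) \<in> E \<times> A" using x y by auto
    from CP_hermitian_preserving[OF N fin' this]
    show "cnj (N (munit (fst x, i) (fst y, j)) (fst p, k) (fst q, l)) *
        cnj (?\<Theta> (map_unit i j k l) (munit (snd x) (snd y)) (snd p) (snd q)) =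
      N (munit (fst y, j) (fst x, i)) (fst q, l) (fst p, k) *
       ?\<Theta> (map_unit j i l k) (munit (snd y) (snd x)) (snd q) (snd p)"
      by (simp add: d[symmetric])
  qed
  also have "\<dots> = (\<Sum>j\<in>A. \<Sum>i\<in>A. \<Sum>l\<in>B. \<Sum>k\<in>B. N (munit (fst y, j) (fst x, i)) (fst q, l) (fst p, k) *
       ?\<Theta> (map_unit j i l k) (munit (snd y) (snd x)) (snd q) (snd p))"
    by (subst sum.swap, rule sum.cong[OF refl], rule sum.cong[OF refl], rule sum.swap)
  also have "\<dots> = id_tensor_supermap E E A B C ?\<Theta> N (munit y x) q p"
    unfolding id_tensor_supermap_munit[OF fin(1,4) y x pq(2,1)] ..
  finally show ?thesis ..
qed

text \<open>Excluding \<open>- \<infinity>\<close> from both sets lets addition commute with the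
  suprema, one argument at a time.\<close>

lemma ereal_uminus_Sup_add_le:
  fixes z :: ereal
  assumes le: "\<And>a b. a \<in> S \<Longrightarrow> b \<in> T \<Longrightarrow> a + b \<le> z" and "- \<infinity> \<notin> S" "- \<infinity> \<notin> T"
  shows "- z \<le> - Sup S + - Sup T"
proof (cases "S = {} \<or> T = {}")
  case True
  \<comment> \<open>The supremum of an empty set is \<open>- \<infinity>\<close>; its negative is
    \<open>\<infinity>\<close>, which absorbs the other summand.\<close>
  then show ?thesis by (auto simp: bot_ereal_def)
next
  case False
  then obtain a b where ab: "a \<in> S" "b \<in> T" by auto
  have "Sup S \<noteq> - \<infinity>" "Sup T \<noteq> - \<infinity>"
    using ab assms(2,3) Sup_upper[OF ab(1)] Sup_upper[OF ab(2)] by auto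
  moreover have "Sup S + b \<le> z" if "b \<in> T" for b
  proof -
    have "b \<noteq> - \<infinity>" using that assms(3) by metis
    then have "Sup S + b = (SUP a\<in>S. a + b)"
      using SUP_ereal_add_left[of S b "\<lambda>x. x"] False by simp
    also have "\<dots> \<le> z" using le that by (intro SUP_least) auto
    finally show ?thesis .
  qed
  then have "(SUP b\<in>T. Sup S + b) \<le> z" by (intro SUP_least) auto
  then have "Sup S + Sup T \<le> z"
    using SUP_ereal_add_right[of T "Sup S" "\<lambda>x. x"] False calculation(1) by simp
  ultimately show ?thesis
    by (cases "Sup S"; cases "Sup T"; cases z) auto
qed

text \<open>Flattening the four nested suprema into one makes a choice of both references, channel
  and state a single competitor.\<close>

lemma superchannel_div_Sup:
  "superchannel_div A B C D \<Theta> \<Gamma> =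
    Sup {rel_entropy ({..<m} \<times> ({..<n} \<times> D))
        (id_tensor_map {..<m} ({..<n} \<times> C) (id_tensor_supermap {..<n} {..<n} A B C \<Theta> N) \<rho>)
        (id_tensor_map {..<m} ({..<n} \<times> C) (id_tensor_supermap {..<n} {..<n} A B C \<Gamma> N) \<rho>) | m n N \<rho>.
      n > (0::nat) \<and> N \<in> channels ({..<n} \<times> A) ({..<n} \<times> B) \<and> m > (0::nat) \<and> \<rho> \<in> states ({..<m} \<times> ({..<n} \<times> C))}"
    (is "_ = Sup ?X")
proof (rule antisym)
  show "superchannel_div A B C D \<Theta> \<Gamma> \<le> Sup ?X"
    unfolding superchannel_div_def channel_div_def
    by (intro SUP_least Sup_upper CollectI exI conjI refl) auto
  show "Sup ?X \<le> superchannel_div A B C D \<Theta> \<Gamma>"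
    unfolding superchannel_div_def channel_div_def
  proof (rule Sup_least, clarify)
    fix m n :: nat and N \<rho>
    assume "n > 0" "m > 0" and N: "N \<in> channels ({..<n} \<times> A) ({..<n} \<times> B)"
      and \<rho>: "\<rho> \<in> states ({..<m} \<times> ({..<n} \<times> C))"
    then have n: "n \<in> {0<..}" and m: "m \<in> {0<..}" by auto
    show "rel_entropy ({..<m} \<times> ({..<n} \<times> D))
        (id_tensor_map {..<m} ({..<n} \<times> C) (id_tensor_supermap {..<n} {..<n} A B C \<Theta> N) \<rho>)
        (id_tensor_map {..<m} ({..<n} \<times> C) (id_tensor_supermap {..<n} {..<n} A B C \<Gamma> N) \<rho>) \<le>
      (SUP n\<in>{0::nat<..}. SUP N\<in>channels ({..<n} \<times> A) ({..<n} \<times> B). SUP m\<in>{0::nat<..}.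
        SUP \<rho>\<in>states ({..<m} \<times> ({..<n} \<times> C)). rel_entropy ({..<m} \<times> ({..<n} \<times> D))
          (id_tensor_map {..<m} ({..<n} \<times> C) (id_tensor_supermap {..<n} {..<n} A B C \<Theta> N) \<rho>)
          (id_tensor_map {..<m} ({..<n} \<times> C) (id_tensor_supermap {..<n} {..<n} A B C \<Gamma> N) \<rho>))"
      by (rule SUP_upper2[OF n], rule SUP_upper2[OF N], rule SUP_upper2[OF m],
          rule SUP_upper2[OF \<rho>], rule order_refl)
  qed
qed

lemma rel_entropy_neq_minus_infty: "rel_entropy A \<rho> \<sigma> \<noteq> - \<infinity>"
  by (simp add: rel_entropy_def)

theorem proposition11:
  fixes A :: "'a set" and B :: "'b set" and C :: "'c set" and D :: "'d set"
    and A' :: "'e set" and B' :: "'f set" and C' :: "'g set" and D' :: "'h set"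
    and \<Theta> :: "('a, 'b, 'c, 'd) supermap" and \<Gamma> :: "('e, 'f, 'g, 'h) supermap"
  assumes "hilbert_space A" and "hilbert_space B" and "hilbert_space C" and "hilbert_space D"
    and "hilbert_space A'" and "hilbert_space B'" and "hilbert_space C'" and "hilbert_space D'"
    and "superchannel A B C D \<Theta>" and "superchannel A' B' C' D' \<Gamma>"
  shows "superchannel_entropy (A \<times> A') (B \<times> B') (C \<times> C') (D \<times> D')
           (tensor_supermap A B C A' B' C' \<Theta> \<Gamma>)
         \<le> superchannel_entropy A B C D \<Theta> + superchannel_entropy A' B' C' D' \<Gamma>"
proof -
  note hA = assms(1-4) and hA' = assms(5-8)
  have fin: "finite A" "finite B" "finite C" "finite D" "finite A'" "finite B'" "finite C'" "finite D'"
    and ne: "A \<noteq> {}" "B \<noteq> {}" "A' \<noteq> {}" "B' \<noteq> {}"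
    using assms(1-8) by (auto simp: hilbert_space_def)
  let ?R = "depol_supermap A B C D" and ?R' = "depol_supermap A' B' C' D'"
  let ?\<Theta>\<Gamma> = "tensor_supermap A B C A' B' C' \<Theta> \<Gamma>" and ?RR = "tensor_supermap A B C A' B' C' ?R ?R'"
  have RR: "depol_supermap (A \<times> A') (B \<times> B') (C \<times> C') (D \<times> D') = ?RR"
    by (rule depol_supermap_tensor) (rule fin)+
  have \<Theta>o: "\<forall>i\<in>A. \<forall>j\<in>A. \<forall>k\<in>B. \<forall>l\<in>B. \<forall>Y. \<Theta> (map_unit i j k l) Y \<in> opers D"
    using assms(9) map_unit_lmaps[of _ A _ _ B] by (auto simp: superchannel_def supermaps_def lmaps_def)
  have \<Gamma>o: "\<forall>i\<in>A'. \<forall>j\<in>A'. \<forall>k\<in>B'. \<forall>l\<in>B'. \<forall>Y. \<Gamma> (map_unit i j k l) Y \<in> opers D'"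
    using assms(10) map_unit_lmaps[of _ A' _ _ B'] by (auto simp: superchannel_def supermaps_def lmaps_def)
  have Ro: "\<forall>i\<in>A. \<forall>j\<in>A. \<forall>k\<in>B. \<forall>l\<in>B. \<forall>Y. ?R (map_unit i j k l) Y \<in> opers D"
    "\<forall>i\<in>A'. \<forall>j\<in>A'. \<forall>k\<in>B'. \<forall>l\<in>B'. \<forall>Y. ?R' (map_unit i j k l) Y \<in> opers D'"
    by (simp_all add: depol_supermap_opers)
  have key: "rel_entropy ({..<m} \<times> ({..<n} \<times> D))
        (id_tensor_map {..<m} ({..<n} \<times> C) (id_tensor_supermap {..<n} {..<n} A B C \<Theta> N) \<rho>)
        (id_tensor_map {..<m} ({..<n} \<times> C) (id_tensor_supermap {..<n} {..<n} A B C ?R N) \<rho>) +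
      rel_entropy ({..<m'} \<times> ({..<n'} \<times> D'))
        (id_tensor_map {..<m'} ({..<n'} \<times> C') (id_tensor_supermap {..<n'} {..<n'} A' B' C' \<Gamma> N') \<rho>')
        (id_tensor_map {..<m'} ({..<n'} \<times> C') (id_tensor_supermap {..<n'} {..<n'} A' B' C' ?R' N') \<rho>')
      \<le> superchannel_div (A \<times> A') (B \<times> B') (C \<times> C') (D \<times> D') ?\<Theta>\<Gamma> ?RR"
    if n: "n > 0" "n' > 0" "m > 0" "m' > 0"
      and N: "N \<in> channels ({..<n} \<times> A) ({..<n} \<times> B)" and N': "N' \<in> channels ({..<n'} \<times> A') ({..<n'} \<times> B')"
      and \<rho>: "\<rho> \<in> states ({..<m} \<times> ({..<n} \<times> C))" and \<rho>': "\<rho>' \<in> states ({..<m'} \<times> ({..<n'} \<times> C'))"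
    for n n' m m' :: nat and N N' \<rho> \<rho>'
  proof -
    \<comment> \<open>The merged references must again be initial segments; equal cardinalities
      provide bijections with the products.\<close>
    let ?E = "{..<n * n'}" and ?K = "{..<m * m'}"
    obtain \<phi> where \<phi>: "bij_betw \<phi> ?E ({..<n} \<times> {..<n'})"
      using finite_same_card_bij[of ?E "{..<n} \<times> {..<n'}"] by auto
    obtain \<psi> where \<psi>: "bij_betw \<psi> ?K ({..<m} \<times> {..<m'})"
      using finite_same_card_bij[of ?K "{..<m} \<times> {..<m'}"] by auto
    \<comment> \<open>The system labels stay schematic, so the same fact regroups the inputs and
      outputs of both the channels and their images.\<close>
    note sh = bij_betw_shuffle[OF \<phi> bij_betw_id]
    let ?\<sigma> = "shuffle \<phi> id"
    let ?NN = "product_map (?E \<times> (A \<times> A')) (shuffle \<phi> id) (?E \<times> (B \<times> B')) (shuffle \<phi> id) N N'"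
    let ?\<rho>\<rho> = "pull_op (?K \<times> (?E \<times> (C \<times> C'))) (shuffle \<psi> (shuffle \<phi> id)) (tensor_op \<rho> \<rho>')"
    let ?M = "id_tensor_supermap {..<n} {..<n} A B C \<Theta> N"
    let ?M' = "id_tensor_supermap {..<n'} {..<n'} A' B' C' \<Gamma> N'"
    let ?S = "id_tensor_supermap {..<n} {..<n} A B C ?R N"
    let ?S' = "id_tensor_supermap {..<n'} {..<n'} A' B' C' ?R' N'"
    have NN: "?NN \<in> channels (?E \<times> (A \<times> A')) (?E \<times> (B \<times> B'))"
    proof -
      have "CP (?E \<times> (A \<times> A')) (?E \<times> (B \<times> B')) ?NN"
        using N N' fin ne n
        by (intro product_map_CP[OF _ _ _ _ _ _ _ sh equalityD1[OF bij_betw_imp_surj_on[OF sh]]])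
          (auto simp: channels_def)
      moreover have "TP (?E \<times> (A \<times> A')) (?E \<times> (B \<times> B')) ?NN"
        using N N' fin by (intro product_map_TP[OF _ _ sh sh]) (auto simp: channels_def)
      ultimately show ?thesis by (simp add: channels_def)
    qed
    have \<rho>\<rho>: "?\<rho>\<rho> \<in> states (?K \<times> (?E \<times> (C \<times> C')))"
      using fin by (intro states_product[OF _ _ bij_betw_shuffle[OF \<psi> sh] \<rho> \<rho>']) auto
    have Mch: "?M \<in> channels ({..<n} \<times> C) ({..<n} \<times> D)"
      by (rule superchannel_id_channel[OF assms(9) hA n(1) N])
    have M'ch: "?M' \<in> channels ({..<n'} \<times> C') ({..<n'} \<times> D')"
      by (rule superchannel_id_channel[OF assms(10) hA' n(2) N'])
    \<comment> \<open>Stated for arbitrary supermaps with values in the right operator spaces,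
      because the two arguments of the relative entropy factorise alike: once for
      \<open>\<Theta>\<close> and \<open>\<Gamma>\<close>, once for the depolarizing
      supermaps.\<close>
    have prod: "id_tensor_map ?K (?E \<times> (C \<times> C')) (id_tensor_supermap ?E ?E (A \<times> A') (B \<times> B') (C \<times> C')
          (tensor_supermap A B C A' B' C' \<Theta>0 \<Gamma>0) ?NN) ?\<rho>\<rho> =
        pull_op (?K \<times> (?E \<times> (D \<times> D'))) (shuffle \<psi> (shuffle \<phi> id))
         (tensor_op (id_tensor_map {..<m} ({..<n} \<times> C) (id_tensor_supermap {..<n} {..<n} A B C \<Theta>0 N) \<rho>)
           (id_tensor_map {..<m'} ({..<n'} \<times> C') (id_tensor_supermap {..<n'} {..<n'} A' B' C' \<Gamma>0 N') \<rho>'))"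
      if "\<forall>i\<in>A. \<forall>j\<in>A. \<forall>k\<in>B. \<forall>l\<in>B. \<forall>Y. \<Theta>0 (map_unit i j k l) Y \<in> opers D"
        "\<forall>i\<in>A'. \<forall>j\<in>A'. \<forall>k\<in>B'. \<forall>l\<in>B'. \<forall>Y. \<Gamma>0 (map_unit i j k l) Y \<in> opers D'"
      for \<Theta>0 :: "('a, 'b, 'c, 'd) supermap" and \<Gamma>0 :: "('e, 'f, 'g, 'h) supermap"
    proof (rule id_tensor_map_product[OF _ _ _ _ _ \<psi> sh])
      show "id_tensor_supermap ?E ?E (A \<times> A') (B \<times> B') (C \<times> C')
          (tensor_supermap A B C A' B' C' \<Theta>0 \<Gamma>0) ?NN (munit x y) \<in> opers (?E \<times> (D \<times> D'))" for x y
        using that by (intro id_tensor_supermap_opers tensor_supermap_opers) auto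
      fix x y p q assume "x \<in> ?E \<times> (C \<times> C')" "y \<in> ?E \<times> (C \<times> C')" "p \<in> ?E \<times> (D \<times> D')" "q \<in> ?E \<times> (D \<times> D')"
      then show "id_tensor_supermap ?E ?E (A \<times> A') (B \<times> B') (C \<times> C')
          (tensor_supermap A B C A' B' C' \<Theta>0 \<Gamma>0) ?NN (munit x y) p q =
        id_tensor_supermap {..<n} {..<n} A B C \<Theta>0 N (munit (fst (?\<sigma> x)) (fst (?\<sigma> y))) (fst (?\<sigma> p)) (fst (?\<sigma> q)) *
        id_tensor_supermap {..<n'} {..<n'} A' B' C' \<Gamma>0 N' (munit (snd (?\<sigma> x)) (snd (?\<sigma> y))) (snd (?\<sigma> p)) (snd (?\<sigma> q))"
        using fin by (intro id_tensor_supermap_product[OF _ _ _ _ _ _ _ _ _ \<phi>]) auto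
    qed (use fin in auto)
    have herm: "hermitian ({..<m} \<times> ({..<n} \<times> D)) (id_tensor_map {..<m} ({..<n} \<times> C) ?M \<rho>)"
      using Mch \<rho> n fin by (intro positive_hermitian) (auto simp: channels_def CP_def states_def)
    have herm': "hermitian ({..<m'} \<times> ({..<n'} \<times> D')) (id_tensor_map {..<m'} ({..<n'} \<times> C') ?M' \<rho>')"
      using M'ch \<rho>' n fin by (intro positive_hermitian) (auto simp: channels_def CP_def states_def)
    have hermS: "hermitian ({..<m} \<times> ({..<n} \<times> D)) (id_tensor_map {..<m} ({..<n} \<times> C) ?S \<rho>)"
    proof (rule hermitian_id_tensor_map)
      show "?S (munit x y) \<in> opers ({..<n} \<times> D)" for x y
        by (intro id_tensor_supermap_opers depol_supermap_opers)
      show "?S (munit y x) q p = cnj (?S (munit x y) p q)"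
        if "x \<in> {..<n} \<times> C" "y \<in> {..<n} \<times> C" "p \<in> {..<n} \<times> D" "q \<in> {..<n} \<times> D" for x y p q
        using N fin that by (intro id_depol_hermitian) (auto simp: channels_def)
      show "hermitian ({..<m} \<times> {..<n} \<times> C) \<rho>"
        using \<rho> fin by (intro positive_hermitian) (auto simp: states_def)
    qed (use fin in auto)
    have hermS': "hermitian ({..<m'} \<times> ({..<n'} \<times> D')) (id_tensor_map {..<m'} ({..<n'} \<times> C') ?S' \<rho>')"
    proof (rule hermitian_id_tensor_map)
      show "?S' (munit x y) \<in> opers ({..<n'} \<times> D')" for x y
        by (intro id_tensor_supermap_opers depol_supermap_opers)
      show "?S' (munit y x) q p = cnj (?S' (munit x y) p q)"
        if "x \<in> {..<n'} \<times> C'" "y \<in> {..<n'} \<times> C'" "p \<in> {..<n'} \<times> D'" "q \<in> {..<n'} \<times> D'" for x y p q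
        using N' fin that by (intro id_depol_hermitian) (auto simp: channels_def)
      show "hermitian ({..<m'} \<times> {..<n'} \<times> C') \<rho>'"
        using \<rho>' fin by (intro positive_hermitian) (auto simp: states_def)
    qed (use fin in auto)
    have trM: "tr ({..<m} \<times> ({..<n} \<times> D)) (id_tensor_map {..<m} ({..<n} \<times> C) ?M \<rho>) = 1"
      using Mch \<rho> fin by (subst tr_id_tensor_map) (auto simp: channels_def states_def)
    have trM': "tr ({..<m'} \<times> ({..<n'} \<times> D')) (id_tensor_map {..<m'} ({..<n'} \<times> C') ?M' \<rho>') = 1"
      using M'ch \<rho>' fin by (subst tr_id_tensor_map) (auto simp: channels_def states_def)
    have finD: "finite ({..<m} \<times> ({..<n} \<times> D))" "finite ({..<m'} \<times> ({..<n'} \<times> D'))" using fin by auto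
    have "rel_entropy ({..<m} \<times> ({..<n} \<times> D)) (id_tensor_map {..<m} ({..<n} \<times> C) ?M \<rho>) (id_tensor_map {..<m} ({..<n} \<times> C) ?S \<rho>) +
        rel_entropy ({..<m'} \<times> ({..<n'} \<times> D')) (id_tensor_map {..<m'} ({..<n'} \<times> C') ?M' \<rho>') (id_tensor_map {..<m'} ({..<n'} \<times> C') ?S' \<rho>') =
      rel_entropy (?K \<times> (?E \<times> (D \<times> D')))
        (id_tensor_map ?K (?E \<times> (C \<times> C')) (id_tensor_supermap ?E ?E (A \<times> A') (B \<times> B') (C \<times> C') ?\<Theta>\<Gamma> ?NN) ?\<rho>\<rho>)
        (id_tensor_map ?K (?E \<times> (C \<times> C')) (id_tensor_supermap ?E ?E (A \<times> A') (B \<times> B') (C \<times> C') ?RR ?NN) ?\<rho>\<rho>)"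
      unfolding prod[of \<Theta> \<Gamma>, OF \<Theta>o \<Gamma>o] prod[of ?R ?R', OF Ro]
      by (rule rel_entropy_product[OF finD bij_betw_shuffle[OF \<psi> sh] herm hermS herm' hermS' trM trM', symmetric])
    also have "\<dots> \<le> superchannel_div (A \<times> A') (B \<times> B') (C \<times> C') (D \<times> D') ?\<Theta>\<Gamma> ?RR"
      unfolding superchannel_div_Sup
      by (rule Sup_upper, rule CollectI, intro exI conjI, rule refl) (use n NN \<rho>\<rho> in auto)
    finally show ?thesis .
  qed
  show ?thesis
    unfolding superchannel_entropy_def RR superchannel_div_Sup[of A B C D] superchannel_div_Sup[of A' B' C' D']
    by (rule ereal_uminus_Sup_add_le) (use key in \<open>auto simp: rel_entropy_neq_minus_infty[symmetric]\<close>)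
qed

end
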